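(* Let $T:L^2(\mathbb{R})\to L^2(\mathbb{R})$ be a bounded operator that is linear or anti-linear. If $$|A(Tu)(x,y)|=|A(u)(x,y)|\quad\text{for all }x,y\in\mathbb{R}\text{ and all }u\in L^2(\mathbb{R}),$$ then there exist $c\in\mathbb{C}$ with $|c|=1$ and $\alpha,\beta\in\mathbb{R}$ such that either $Tu(t)=c\,e^{i\beta t}\,u(t-\alpha)$ for all $u\in L^2(\mathbb{R})$, or $Tu(t)=c\,e^{-i\beta t}\,u(-t-\alpha)$ for all $u\in L^2(\mathbb{R})$. Conversely, every operator $T$ of one of these two forms satisfies $|A(Tu)(x,y)|=|A(u)(x,y)|$ for all $x,y\in\mathbb{R}$ and all $u\in L^2(\mathbb{R})$.
   Context: For $u\in L^2(\mathbb{R})$ the radar ambiguity function is $A(u)(x,y)=\int_{\mathbb{R}}u(t)\,\overline{u(t-x)}\,e^{iyt}\,dt$, $x,y\in\mathbb{R}$. Equalities of $L^2$ functions are understood almost everywhere. *)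

theory Defs
  imports "HOL-Analysis.Analysis"
begin

text \<open>Elements of the Hilbert space \<open>L\<^sup>2(\<real>)\<close> are represented by Borel square-integrable
  functions, and two representatives denote the same element iff they agree almost everywhere.
  Every Lebesgue class has a Borel representative, so using \<^const>\<open>lborel\<close> loses nothing.\<close>

definition L2 :: "(real \<Rightarrow> complex) set" where
  "L2 = {u. u \<in> borel_measurable lborel \<and> integrable lborel (\<lambda>t. (cmod (u t))\<^sup>2)}"

definition L2_eq :: "(real \<Rightarrow> complex) \<Rightarrow> (real \<Rightarrow> complex) \<Rightarrow> bool" where
  "L2_eq u v \<longleftrightarrow> (AE t in lborel. u t = v t)"

definition L2_norm :: "(real \<Rightarrow> complex) \<Rightarrow> real" where
  "L2_norm u = sqrt (LINT t|lborel. (cmod (u t))\<^sup>2)"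

text \<open>A map on representatives that descends to a map \<open>L\<^sup>2(\<real>) \<rightarrow> L\<^sup>2(\<real>)\<close>. Its values outside
  \<^const>\<open>L2\<close> are irrelevant.\<close>

definition L2_map :: "((real \<Rightarrow> complex) \<Rightarrow> real \<Rightarrow> complex) \<Rightarrow> bool" where
  "L2_map T \<longleftrightarrow>
     (\<forall>u\<in>L2. T u \<in> L2) \<and> (\<forall>u\<in>L2. \<forall>v\<in>L2. L2_eq u v \<longrightarrow> L2_eq (T u) (T v))"

definition L2_additive :: "((real \<Rightarrow> complex) \<Rightarrow> real \<Rightarrow> complex) \<Rightarrow> bool" where
  "L2_additive T \<longleftrightarrow>
     (\<forall>u\<in>L2. \<forall>v\<in>L2. L2_eq (T (\<lambda>t. u t + v t)) (\<lambda>t. T u t + T v t))"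

definition L2_linear :: "((real \<Rightarrow> complex) \<Rightarrow> real \<Rightarrow> complex) \<Rightarrow> bool" where
  "L2_linear T \<longleftrightarrow>
     L2_additive T \<and> (\<forall>a. \<forall>u\<in>L2. L2_eq (T (\<lambda>t. a * u t)) (\<lambda>t. a * T u t))"

definition L2_antilinear :: "((real \<Rightarrow> complex) \<Rightarrow> real \<Rightarrow> complex) \<Rightarrow> bool" where
  "L2_antilinear T \<longleftrightarrow>
     L2_additive T \<and> (\<forall>a. \<forall>u\<in>L2. L2_eq (T (\<lambda>t. a * u t)) (\<lambda>t. cnj a * T u t))"

definition L2_bounded :: "((real \<Rightarrow> complex) \<Rightarrow> real \<Rightarrow> complex) \<Rightarrow> bool" where
  "L2_bounded T \<longleftrightarrow> (\<exists>K. \<forall>u\<in>L2. L2_norm (T u) \<le> K * L2_norm u)"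

definition ambiguity :: "(real \<Rightarrow> complex) \<Rightarrow> real \<Rightarrow> real \<Rightarrow> complex" where
  "ambiguity u x y =
     (LINT t|lborel. u t * cnj (u (t - x)) * exp (\<i> * complex_of_real y * complex_of_real t))"

end

theory Submission
  imports Defs "HOL-Probability.Levy"
begin

text \<open>Write \<open>W\<^sub>z\<close>, \<open>z = (x, y)\<close>, for the phase space shift \<open>u \<mapsto> e\<^sup>-\<^sup>i\<^sup>y\<^sup>t u(t - x)\<close>, so that
  \<open>A(u)(x, y) = \<langle>u, W\<^sub>z u\<rangle>\<close>. If \<open>T\<close> is linear, the sesquilinear forms \<open>\<langle>T u, W\<^sub>z T v\<rangle>\<close> and
  \<open>\<langle>u, W\<^sub>z v\<rangle>\<close> have the same modulus on the diagonal. Two such forms agree up to a unimodular factor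
  and possibly passing to the adjoint form, hence \<open>W\<^sub>z T = c\<^sub>z T W\<^sub>\<plusminus>\<^sub>z\<close>. The commutation relations
  of the shifts force the sign to be the same for all translations and modulations, and after composing
  \<open>T\<close> with the reflection \<open>t \<mapsto> -t\<close> it is \<open>+\<close>. For an antilinear \<open>T\<close> the same argument, applied to \<open>T\<close>
  composed with complex conjugation, gives three phase space shifts with pairwise opposite signs, which
  is absurd.

  If \<open>T\<close> commutes with all translations and modulations up to phases, the phases of the modulations
  form a continuous character, and uniqueness of Fourier transforms gives
  \<open>T u \<sqdot> cnj (T v) = u(\<sqdot> - \<alpha>) \<sqdot> cnj (v(\<sqdot> - \<alpha>))\<close> for some \<open>\<alpha>\<close>. So \<open>T u = m \<sqdot> u(\<sqdot> - \<alpha>)\<close> with a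
  unimodular \<open>m\<close>, and the phases of the translations show that \<open>m\<close> is a multiple of a character.\<close>

section \<open>Fourier transforms of integrable functions\<close>

lemma integrable_iexp_mult:
  fixes g :: "real \<Rightarrow> complex"
  assumes "integrable lborel g"
  shows "integrable lborel (\<lambda>t. iexp (y * t) * g t)"
proof -
  have [measurable]: "g \<in> borel_measurable borel" using assms by auto
  show ?thesis
    by (rule Bochner_Integration.integrable_bound[OF assms]) (auto simp: norm_mult)
qed

text \<open>Frequency 0 shows that both functions have the same mass \<open>a\<close>. If
  \<open>a\<close> is positive, dividing by it gives two probability densities with equal
  characteristic functions, and Levy's uniqueness theorem applies.\<close>

lemma fourier_uniqueness_nonneg:
  fixes p q :: "real \<Rightarrow> real"
  assumes p: "integrable lborel p" "\<And>t. p t \<ge> 0" and q: "integrable lborel q" "\<And>t. q t \<ge> 0"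
    and eq: "\<And>y. (LINT t|lborel. iexp (y * t) * of_real (p t)) = (LINT t|lborel. iexp (y * t) * of_real (q t))"
  shows "AE t in lborel. p t = q t"
proof -
  have m[measurable]: "p \<in> borel_measurable borel" "q \<in> borel_measurable borel"
    using p(1) q(1) by auto
  define a where "a = (LINT t|lborel. p t)"
  have aq: "(LINT t|lborel. q t) = a"
    using eq[of 0] p q by (simp add: a_def)
  have a0: "a \<ge> 0" unfolding a_def using p by simp
  show ?thesis
  proof (cases "a = 0")
    case True
    have "AE t in lborel. p t = 0"
      using integral_nonneg_eq_0_iff_AE[OF p(1)] p(2) True a_def by auto
    moreover have "AE t in lborel. q t = 0"
      using integral_nonneg_eq_0_iff_AE[OF q(1)] q(2) True aq by auto
    ultimately show ?thesis by eventually_elim auto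
  next
    case False
    define D where "D r = density lborel (\<lambda>t. ennreal (r t / a))" for r :: "real \<Rightarrow> real"
    have rd: "real_distribution (D r)"
      if [measurable]: "r \<in> borel_measurable borel"
        and r: "integrable lborel r" "\<And>t. r t \<ge> 0" "(LINT t|lborel. r t) = a" for r
    proof -
      have "emeasure (D r) (space (D r)) = (\<integral>\<^sup>+ t. ennreal (r t / a) \<partial>lborel)"
        by (simp add: D_def emeasure_density)
      also have "\<dots> = ennreal (LINT t|lborel. r t / a)"
        using r a0 by (intro nn_integral_eq_integral) auto
      also have "\<dots> = 1" using r False by simp
      finally have "prob_space (D r)" by (rule prob_spaceI)
      then show ?thesis
        by (simp add: real_distribution_def real_distribution_axioms_def D_def)
    qed
    have ch: "char (D r) y = (LINT t|lborel. iexp (y * t) * of_real (r t)) / a"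
      if [measurable]: "r \<in> borel_measurable borel" and r: "\<And>t. r t \<ge> 0" for r y
    proof -
      have "char (D r) y = (LINT t|lborel. (r t / a) *\<^sub>R iexp (y * t))"
        unfolding char_def D_def using r a0 by (subst integral_density) auto
      also have "\<dots> = (LINT t|lborel. (iexp (y * t) * of_real (r t)) / a)"
        by (intro Bochner_Integration.integral_cong) (auto simp: scaleR_conv_of_real)
      finally show ?thesis by simp
    qed
    have "char (D p) = char (D q)"
      by (intro ext) (simp only: ch[OF m(1) p(2)] ch[OF m(2) q(2)] eq)
    then have "D p = D q"
      using rd[of p] rd[of q] p q aq a_def by (intro Levy_uniqueness) auto
    then have "AE t in lborel. ennreal (p t / a) = ennreal (q t / a)"
      unfolding D_def by (intro sigma_finite_measure.density_unique[OF lborel.sigma_finite_measure_axioms]) auto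
    then show ?thesis
      using p q a0 False by (auto simp: ennreal_inj elim!: eventually_mono)
  qed
qed

text \<open>The positive and negative parts of \<open>f\<close> are nonnegative, and the difference
  of their transforms is the transform of \<open>f\<close>.\<close>

lemma fourier_uniqueness_real:
  fixes f :: "real \<Rightarrow> real"
  assumes f: "integrable lborel f"
    and eq: "\<And>y. (LINT t|lborel. iexp (y * t) * of_real (f t)) = 0"
  shows "AE t in lborel. f t = 0"
proof -
  have [measurable]: "f \<in> borel_measurable borel" using f by auto
  have i: "integrable lborel (\<lambda>t. max 0 (f t))" "integrable lborel (\<lambda>t. max 0 (- f t))"
    using f by (auto intro: integrable_max)
  have "AE t in lborel. max 0 (f t) = max 0 (- f t)"
  proof (rule fourier_uniqueness_nonneg[OF i(1) _ i(2)])
    fix y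
    have "(LINT t|lborel. iexp (y * t) * of_real (max 0 (f t))) -
          (LINT t|lborel. iexp (y * t) * of_real (max 0 (- f t))) =
          (LINT t|lborel. iexp (y * t) * of_real (f t))"
      unfolding Bochner_Integration.integral_diff[OF integrable_iexp_mult[OF integrable_of_real[OF i(1)]]
          integrable_iexp_mult[OF integrable_of_real[OF i(2)]], symmetric]
      by (intro Bochner_Integration.integral_cong) (auto simp: max_def)
    then show "(LINT t|lborel. iexp (y * t) * of_real (max 0 (f t))) =
          (LINT t|lborel. iexp (y * t) * of_real (max 0 (- f t)))"
      by (simp only: eq right_minus_eq)
  qed auto
  then show ?thesis by eventually_elim (auto simp: max_def split: if_splits)
qed

text \<open>The transform of \<open>cnj f\<close> at \<open>y\<close> is the conjugate of that of
  \<open>f\<close> at \<open>-y\<close>, so it vanishes too, and with it the transforms of the real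
  and imaginary parts.\<close>

lemma fourier_uniqueness:
  fixes f :: "real \<Rightarrow> complex"
  assumes f: "integrable lborel f"
    and eq: "\<And>y. (LINT t|lborel. iexp (y * t) * f t) = 0"
  shows "AE t in lborel. f t = 0"
proof -
  have [measurable]: "f \<in> borel_measurable borel" using f by auto
  have cf: "integrable lborel (\<lambda>t. cnj (f t))" using f by simp
  have eq': "(LINT t|lborel. iexp (y * t) * cnj (f t)) = 0" for y
  proof -
    have "(LINT t|lborel. iexp (y * t) * cnj (f t)) = (LINT t|lborel. cnj (iexp (- y * t) * f t))"
      by (intro Bochner_Integration.integral_cong) (auto simp: exp_cnj)
    also have "\<dots> = cnj (LINT t|lborel. iexp (- y * t) * f t)" by (rule Bochner_Integration.integral_cnj)
    finally show ?thesis using eq[of "-y"] by simp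
  qed
  have "AE t in lborel. Re (f t) = 0"
  proof (rule fourier_uniqueness_real)
    fix y
    have "(LINT t|lborel. iexp (y * t) * of_real (Re (f t))) =
      (LINT t|lborel. (iexp (y * t) * f t + iexp (y * t) * cnj (f t)) / 2)"
      by (intro Bochner_Integration.integral_cong) (auto simp: complex_add_cnj simp flip: distrib_left)
    also have "\<dots> = 0" using integrable_iexp_mult[OF f, of y] integrable_iexp_mult[OF cf, of y] eq[of y] eq'[of y] by simp
    finally show "(LINT t|lborel. iexp (y * t) * of_real (Re (f t))) = 0" .
  qed (use f in simp)
  moreover have "AE t in lborel. Im (f t) = 0"
  proof (rule fourier_uniqueness_real)
    fix y
    have im: "of_real (Im z) = (z - cnj z) / (2 * \<i>)" for z
      by (simp add: complex_eq_iff)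
    have "(LINT t|lborel. iexp (y * t) * of_real (Im (f t))) =
      (LINT t|lborel. (iexp (y * t) * f t - iexp (y * t) * cnj (f t)) / (2 * \<i>))"
      by (simp only: im times_divide_eq_right right_diff_distrib)
    also have "\<dots> = 0" using integrable_iexp_mult[OF f, of y] integrable_iexp_mult[OF cf, of y] eq[of y] eq'[of y] by simp
    finally show "(LINT t|lborel. iexp (y * t) * of_real (Im (f t))) = 0" .
  qed (use f in simp)
  ultimately show ?thesis by eventually_elim (auto simp: complex_eq_iff)
qed

lemma isCont_fourier:
  fixes f :: "real \<Rightarrow> complex"
  assumes f: "integrable lborel f"
  shows "isCont (\<lambda>y. LINT t|lborel. iexp (y * t) * f t) a"
  unfolding continuous_at_sequentially
proof safe
  fix X assume X: "X \<longlonglongrightarrow> a"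
  have [measurable]: "f \<in> borel_measurable borel" using f by auto
  show "((\<lambda>y. LINT t|lborel. iexp (y * t) * f t) \<circ> X) \<longlonglongrightarrow> (LINT t|lborel. iexp (a * t) * f t)"
    unfolding comp_def
    by (rule integral_dominated_convergence[where w="\<lambda>t. norm (f t)"])
       (use f X in \<open>auto intro!: tendsto_intros simp: norm_mult\<close>)
qed

text \<open>Averaging over a short interval shows that \<open>c\<close> is differentiable. The
  functional equation then becomes \<open>c' = k * c\<close>, and modulus 1 makes \<open>k\<close>
  purely imaginary.\<close>

lemma continuous_character:
  fixes c :: "real \<Rightarrow> complex"
  assumes add: "\<And>x y. c (x + y) = c x * c y" and one: "\<And>x. cmod (c x) = 1" and cont: "isCont c 0"
  shows "\<exists>b. \<forall>x. c x = exp (\<i> * of_real b * of_real x)"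
proof -
  have nz: "c x \<noteq> 0" for x using one[of x] by auto
  have c0: "c 0 = 1" using add[of 0 0] nz[of 0] by simp
  have cont': "isCont c x" for x
  proof -
    have "(\<lambda>h. c x * c h) \<midarrow>0\<rightarrow> c x * c 0"
      using cont by (intro tendsto_intros) (auto simp: isCont_def)
    then have "(\<lambda>h. c (x + h)) \<midarrow>0\<rightarrow> c x" by (simp add: add c0)
    then show ?thesis by (simp add: isCont_iff)
  qed
  then have con: "continuous_on A c" for A by (simp add: continuous_at_imp_continuous_on)
  \<comment> \<open>Staying within 1/2 of the value 1 keeps the mean of \<open>c\<close> over
    \<open>{0..h}\<close> away from 0, so that \<open>K\<close> can be divided by.\<close>
  obtain d where d: "d > 0" "\<And>x. dist x 0 < d \<Longrightarrow> dist (c x) 1 < 1/2"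
    using cont[unfolded continuous_at_eps_delta] c0 by (metis half_gt_zero_iff zero_less_one)
  define h where "h = d / 2"
  have h: "h > 0" "\<And>x. x \<in> {0..h} \<Longrightarrow> cmod (c x - 1) \<le> 1/2"
    using d by (auto simp: h_def dist_norm abs_if intro!: less_imp_le)
  \<comment> \<open>\<open>c x * K\<close> is the integral of \<open>c\<close> over \<open>{x..x+h}\<close>, so \<open>c\<close> is differentiable.\<close>
  define K where "K = integral {0..h} c"
  have ci: "c integrable_on {a..b}" for a b by (intro integrable_continuous_real con)
  have "norm (K - h) \<le> 1/2 * h"
  proof -
    have "K - h = integral {0..h} (\<lambda>x. c x - 1)"
      using h ci[of 0 h] Henstock_Kurzweil_Integration.integral_diff[OF ci[of 0 h], of "\<lambda>_. 1"] integrable_const_ivl[of "1::complex" 0 h]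
      by (simp add: K_def scaleR_conv_of_real)
    also have "norm \<dots> \<le> 1/2 * (h - 0)"
      using h by (intro integral_bound) (auto intro!: continuous_intros con)
    finally show ?thesis using h by simp
  qed
  then have K: "K \<noteq> 0" using h by auto
  define g where "g x = integral {0..h} (\<lambda>s. c (x + s))" for x
  have gc: "g x = c x * K" for x
    by (simp add: g_def add K_def)
  \<comment> \<open>The lower limit -1 makes 0 an interior point, which gives a two-sided derivative
    there.\<close>
  define E where "E x = integral {-1..x} c" for x
  have E: "(E has_vector_derivative c x) (at x)" if "x > -1" for x
  proof -
    have "(E has_vector_derivative c x) (at x within {-1..x+1})"
      unfolding E_def using that by (intro integral_has_vector_derivative con) auto
    then show ?thesis using that by (simp add: at_within_Icc_at)
  qed
  have gE: "g x = E (x + h) - E x" if "x \<ge> -1" for x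
  proof -
    have "integral {0..h} (\<lambda>s. c (x + s)) = integral {x..x+h} c"
      using integral_shift_Icc_real[of 0 h c x] by (simp add: comp_def add.commute)
    moreover have "E (x+h) = E x + integral {x..x+h} c"
      unfolding E_def using h that ci
      by (intro Henstock_Kurzweil_Integration.integral_combine[symmetric]) auto
    ultimately show ?thesis by (simp add: g_def)
  qed
  define k where "k = (c h - 1) / K"
  have "((\<lambda>x. E (x + h) - E x) has_vector_derivative (c h - c 0)) (at 0)"
  proof (intro has_vector_derivative_diff E)
    have "((E \<circ> (\<lambda>x. x + h)) has_vector_derivative (1 *\<^sub>R c h)) (at 0)"
      using h by (intro vector_diff_chain_at) (auto intro!: derivative_eq_intros E)
    then show "((\<lambda>x. E (x + h)) has_vector_derivative c h) (at 0)" by (simp add: comp_def)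
  qed auto
  then have "((\<lambda>x. c x * K) has_vector_derivative (c h - 1)) (at 0)"
    unfolding c0
    by (rule has_vector_derivative_transform_within_open[where S="{-1<..<1}"]) (auto simp: gE[symmetric] gc)
  then have "((\<lambda>x. c x * K / K) has_vector_derivative ((c h - 1) / K)) (at 0)"
    by (rule has_vector_derivative_divide)
  then have D0: "(c has_vector_derivative k) (at 0)" using K by (simp add: k_def)
  have D: "(c has_vector_derivative (k * c x)) (at x)" for x
  proof -
    have "((c \<circ> (\<lambda>s. s - x)) has_vector_derivative (1 *\<^sub>R k)) (at x)"
      using D0 by (intro vector_diff_chain_at) (auto intro!: derivative_eq_intros)
    then have "((\<lambda>s. c x * c (s - x)) has_vector_derivative (c x * k)) (at x)"
      by (intro has_vector_derivative_mult_right) (simp add: comp_def)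
    moreover have "c x * c (s - x) = c s" for s using add[of x "s - x"] by simp
    ultimately show ?thesis by (simp add: mult.commute)
  qed
  have "((\<lambda>x. c x * exp (- k * of_real x)) has_vector_derivative 0) (at x)" for x
  proof -
    have "((\<lambda>x. exp (- k * of_real x)) has_vector_derivative (-k * exp (-k * of_real x))) (at x)"
      by (rule derivative_eq_intros has_vector_derivative_real_field | simp)+
    from has_vector_derivative_mult[OF D this] show ?thesis by (simp add: algebra_simps)
  qed
  then obtain r where r: "\<And>x. c x * exp (- k * of_real x) = r"
    using has_vector_derivative_zero_constant[of UNIV "\<lambda>x. c x * exp (- k * of_real x)"] by auto
  have "r = 1" using r[of 0] c0 by simp
  have ce: "c x = exp (k * of_real x)" for x
    using r[of x] \<open>r = 1\<close> by (simp add: exp_minus field_simps)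
  have "Re k = 0" using one[of 1] by (simp add: ce)
  then have "k = \<i> * of_real (Im k)" by (simp add: complex_eq_iff)
  then show ?thesis using ce by metis
qed

section \<open>Square-integrable functions\<close>

lemma borel_measurable_cnj [measurable]: "cnj \<in> borel_measurable borel"
  by (intro borel_measurable_continuous_onI continuous_intros)

lemma L2_measurable [measurable_dest]: "u \<in> L2 \<Longrightarrow> u \<in> borel_measurable borel"
  by (simp add: L2_def)

lemma L2_integrable_norm: "u \<in> L2 \<Longrightarrow> integrable lborel (\<lambda>t. (cmod (u t))\<^sup>2)"
  by (simp add: L2_def)

lemma L2_lincomb:
  assumes u: "u \<in> L2" and v: "v \<in> L2"
  shows "(\<lambda>t. a * u t + v t) \<in> L2"
proof -
  have [measurable]: "u \<in> borel_measurable borel" "v \<in> borel_measurable borel"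
    using u v by (auto intro: L2_measurable)
  have "integrable lborel (\<lambda>t. (cmod (a * u t + v t))\<^sup>2)"
  proof (rule Bochner_Integration.integrable_bound)
    show "integrable lborel (\<lambda>t. 2 * (cmod a)\<^sup>2 * (cmod (u t))\<^sup>2 + 2 * (cmod (v t))\<^sup>2)"
      using u v L2_integrable_norm by auto
    show "AE t in lborel. norm ((cmod (a * u t + v t))\<^sup>2)
            \<le> norm (2 * (cmod a)\<^sup>2 * (cmod (u t))\<^sup>2 + 2 * (cmod (v t))\<^sup>2)"
    proof (rule AE_I2)
      fix t
      have "(cmod (a * u t + v t))\<^sup>2 \<le> (cmod a * cmod (u t) + cmod (v t))\<^sup>2"
        by (intro power_mono order_trans[OF norm_triangle_ineq]) (auto simp: norm_mult)
      also have "\<dots> \<le> 2 * (cmod a * cmod (u t))\<^sup>2 + 2 * (cmod (v t))\<^sup>2"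
        using sum_squares_bound[of "cmod a * cmod (u t)" "cmod (v t)"] by (simp add: power2_sum)
      finally show "norm ((cmod (a * u t + v t))\<^sup>2)
            \<le> norm (2 * (cmod a)\<^sup>2 * (cmod (u t))\<^sup>2 + 2 * (cmod (v t))\<^sup>2)"
        by (simp add: power_mult_distrib mult.assoc)
    qed
  qed simp
  then show ?thesis by (simp add: L2_def)
qed

lemma L2_zero: "(\<lambda>t. 0) \<in> L2"
  by (simp add: L2_def)

lemma L2_scale: "u \<in> L2 \<Longrightarrow> (\<lambda>t. a * u t) \<in> L2"
  using L2_lincomb[OF _ L2_zero, of u a] by simp

lemma L2_cnj: "u \<in> L2 \<Longrightarrow> (\<lambda>t. cnj (u t)) \<in> L2"
  by (auto simp: L2_def)

lemma L2_affine:
  assumes u: "u \<in> L2" and a: "a \<noteq> 0"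
  shows "(\<lambda>t. u (b + a * t)) \<in> L2"
proof -
  have [measurable]: "u \<in> borel_measurable borel" using u by (rule L2_measurable)
  show ?thesis
    using lborel_integrable_real_affine[OF L2_integrable_norm[OF u] a, of b] by (simp add: L2_def)
qed

text \<open>The square of this Gaussian is \<open>sqrt (pi / 2)\<close> times the centred normal
  density of standard deviation 1/2. Having no zeros, the function can serve as a divisor
  later.\<close>

lemma L2_nonvanishing: "(\<lambda>t. complex_of_real (exp (- t\<^sup>2))) \<in> L2"
proof -
  have "integrable lborel (\<lambda>t. sqrt (pi / 2) * normal_density 0 (1/2) t)"
    by (intro integrable_mult_right integrable_normal_density) auto
  moreover have "sqrt (pi / 2) * normal_density 0 (1/2) t = (exp (- t\<^sup>2))\<^sup>2" for t
    by (simp add: normal_density_def field_simps power2_eq_square exp_add[symmetric] real_sqrt_divide)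
  ultimately show ?thesis by (simp add: L2_def)
qed

lemma L2_eq_refl: "L2_eq u u"
  by (simp add: L2_eq_def)

lemma L2_eq_sym: "L2_eq u v \<Longrightarrow> L2_eq v u"
  by (auto simp: L2_eq_def elim: eventually_mono)

lemma L2_eq_trans [trans]: "L2_eq u v \<Longrightarrow> L2_eq v w \<Longrightarrow> L2_eq u w"
  by (auto simp: L2_eq_def elim: eventually_elim2)

lemma L2_eq_scale: "L2_eq u v \<Longrightarrow> L2_eq (\<lambda>t. a * u t) (\<lambda>t. a * v t)"
  by (auto simp: L2_eq_def elim: eventually_mono)

lemma L2_eq_affine:
  assumes "L2_eq u v" "u \<in> L2" "v \<in> L2" "a \<noteq> 0"
  shows "L2_eq (\<lambda>t. u (b + a * t)) (\<lambda>t. v (b + a * t))"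
proof -
  have [measurable]: "u \<in> borel_measurable borel" "v \<in> borel_measurable borel"
    using assms by (auto intro: L2_measurable)
  show ?thesis
    using AE_borel_affine[of a "\<lambda>t. u t = v t" b] assms by (simp add: L2_eq_def)
qed

section \<open>The inner product\<close>

definition ip :: "(real \<Rightarrow> complex) \<Rightarrow> (real \<Rightarrow> complex) \<Rightarrow> complex" where
  "ip u v = (LINT t|lborel. u t * cnj (v t))"

lemma ip_integrable:
  assumes u: "u \<in> L2" and v: "v \<in> L2"
  shows "integrable lborel (\<lambda>t. u t * cnj (v t))"
proof -
  have [measurable]: "u \<in> borel_measurable borel" "v \<in> borel_measurable borel"
    using u v by (auto intro: L2_measurable)
  show ?thesis
  proof (rule Bochner_Integration.integrable_bound)
    show "integrable lborel (\<lambda>t. (cmod (u t))\<^sup>2 + (cmod (v t))\<^sup>2)"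
      using u v L2_integrable_norm by auto
    show "AE t in lborel. norm (u t * cnj (v t)) \<le> norm ((cmod (u t))\<^sup>2 + (cmod (v t))\<^sup>2)"
    proof (rule AE_I2)
      fix t
      have "cmod (u t) * cmod (v t) \<le> 2 * cmod (u t) * cmod (v t)" by simp
      also have "\<dots> \<le> (cmod (u t))\<^sup>2 + (cmod (v t))\<^sup>2" by (rule sum_squares_bound)
      finally show "norm (u t * cnj (v t)) \<le> norm ((cmod (u t))\<^sup>2 + (cmod (v t))\<^sup>2)"
        by (simp add: norm_mult)
    qed
  qed simp
qed

lemma ip_lincomb_left:
  assumes "u \<in> L2" "v \<in> L2" "w \<in> L2"
  shows "ip (\<lambda>t. a * u t + v t) w = a * ip u w + ip v w"
proof -
  have "ip (\<lambda>t. a * u t + v t) w = (LINT t|lborel. a * (u t * cnj (w t)) + v t * cnj (w t))"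
    unfolding ip_def by (simp add: algebra_simps)
  then show ?thesis using assms by (simp add: ip_def ip_integrable)
qed

lemma ip_cnj: "ip v u = cnj (ip u v)"
  unfolding ip_def by (subst Bochner_Integration.integral_cnj[symmetric]) (simp add: mult.commute)

lemma ip_lincomb_right:
  assumes "u \<in> L2" "v \<in> L2" "w \<in> L2"
  shows "ip w (\<lambda>t. a * u t + v t) = cnj a * ip w u + ip w v"
  using ip_lincomb_left[OF assms, of a] by (subst ip_cnj) (simp flip: ip_cnj)

lemma ip_scale_left: "ip (\<lambda>t. a * u t) v = a * ip u v"
  by (simp add: ip_def mult.assoc)

lemma ip_scale_right: "ip u (\<lambda>t. a * v t) = cnj a * ip u v"
  by (subst ip_cnj) (simp add: ip_scale_left flip: ip_cnj)

lemma ip_cong: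
  assumes "L2_eq u u'" "L2_eq v v'" "u \<in> L2" "u' \<in> L2" "v \<in> L2" "v' \<in> L2"
  shows "ip u v = ip u' v'"
proof -
  have [measurable]: "u \<in> borel_measurable borel" "v \<in> borel_measurable borel"
     "u' \<in> borel_measurable borel" "v' \<in> borel_measurable borel"
    using assms by (auto intro: L2_measurable)
  have "AE t in lborel. u t * cnj (v t) = u' t * cnj (v' t)"
    using assms(1,2) unfolding L2_eq_def by eventually_elim simp
  then show ?thesis unfolding ip_def by (intro integral_cong_AE) auto
qed

lemma ip_self: "ip u u = of_real (LINT t|lborel. (cmod (u t))\<^sup>2)"
  unfolding ip_def by (subst integral_complex_of_real[symmetric]) (simp only: complex_norm_square)

lemma ip_self_eq_0:
  assumes "u \<in> L2" "ip u u = 0"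
  shows "L2_eq u (\<lambda>t. 0)"
  using assms integral_nonneg_eq_0_iff_AE[OF L2_integrable_norm[OF assms(1)]]
  by (simp add: ip_self L2_eq_def)

lemma ip_self_pos:
  assumes "u \<in> L2" "\<not> L2_eq u (\<lambda>t. 0)"
  shows "ip u u \<noteq> 0"
  using assms ip_self_eq_0 by blast

lemma L2_nontrivial: "\<exists>u\<in>L2. ip u u \<noteq> 0"
proof -
  have "\<not> L2_eq (\<lambda>t. complex_of_real (exp (- t\<^sup>2))) (\<lambda>t. 0)"
    by (simp add: L2_eq_def eventually_False ae_filter_eq_bot_iff)
  then show ?thesis using L2_nonvanishing ip_self_pos by blast
qed

text \<open>Expanding the squared norm of \<open>u - v\<close> gives 0. Operator identities are read
  off from inner products in this way, as the equality case of the Cauchy-Schwarz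
  inequality.\<close>

lemma L2_eq_if_ip:
  assumes "u \<in> L2" "v \<in> L2" "ip u u = ip v v" "ip u v = ip v v"
  shows "L2_eq u v"
proof -
  have d: "(\<lambda>t. -1 * v t + u t) \<in> L2" by (intro L2_lincomb assms)
  have "ip v u = cnj (ip v v)" using assms(4) ip_cnj by metis
  also have "\<dots> = ip v v" by (metis ip_cnj)
  finally have "ip (\<lambda>t. -1 * v t + u t) (\<lambda>t. -1 * v t + u t) = 0"
    using assms d by (simp only: ip_lincomb_left ip_lincomb_right) simp
  from ip_self_eq_0[OF d this] show ?thesis
    by (auto simp: L2_eq_def elim: eventually_mono)
qed

section \<open>Sesquilinear forms with equal modulus on the diagonal\<close>

definition sesq :: "((real \<Rightarrow> complex) \<Rightarrow> (real \<Rightarrow> complex) \<Rightarrow> complex) \<Rightarrow> bool" where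
  "sesq b \<longleftrightarrow> (\<forall>u\<in>L2. \<forall>v\<in>L2. \<forall>w\<in>L2. \<forall>a.
     b (\<lambda>t. a * u t + v t) w = a * b u w + b v w \<and>
     b w (\<lambda>t. a * u t + v t) = cnj a * b w u + b w v)"

lemma sesq_left:
  "sesq b \<Longrightarrow> u \<in> L2 \<Longrightarrow> v \<in> L2 \<Longrightarrow> w \<in> L2 \<Longrightarrow> b (\<lambda>t. a * u t + v t) w = a * b u w + b v w"
  by (simp add: sesq_def)

lemma sesq_right:
  "sesq b \<Longrightarrow> u \<in> L2 \<Longrightarrow> v \<in> L2 \<Longrightarrow> w \<in> L2 \<Longrightarrow> b w (\<lambda>t. a * u t + v t) = cnj a * b w u + b w v"
  by (simp add: sesq_def)

lemma sesq_quadratic: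
  assumes "sesq b" "u \<in> L2" "v \<in> L2"
  shows "b (\<lambda>t. a * v t + u t) (\<lambda>t. a * v t + u t) =
    b u u + a * b v u + cnj a * b u v + a * cnj a * b v v"
  using assms by (simp add: sesq_left sesq_right L2_lincomb) (simp add: algebra_simps)

lemma sesq_diff: "sesq b \<Longrightarrow> sesq w \<Longrightarrow> sesq (\<lambda>u v. b u v - w u v)"
  by (simp add: sesq_def algebra_simps)

lemma sesq_scale: "sesq b \<Longrightarrow> sesq (\<lambda>u v. c * b u v)"
  by (simp add: sesq_def algebra_simps)

lemma sesq_cnj: "sesq b \<Longrightarrow> sesq (\<lambda>u v. cnj (b v u))"
  by (simp add: sesq_def algebra_simps)

text \<open>Polarization: the coefficients 1 and \<open>\<i>\<close> show that both the sum and the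
  difference of \<open>b v u\<close> and \<open>b u v\<close> vanish.\<close>

lemma sesq_zero:
  assumes b: "sesq b" and z: "\<And>v. v \<in> L2 \<Longrightarrow> b v v = 0" and u: "u \<in> L2" and v: "v \<in> L2"
  shows "b u v = 0"
proof -
  have "b v u + b u v = 0"
    using sesq_quadratic[OF b u v, of 1] z u v L2_lincomb[OF v u, of 1] by simp
  moreover have "\<i> * b v u - \<i> * b u v = 0"
    using sesq_quadratic[OF b u v, of \<i>] z u v L2_lincomb[OF v u, of \<i>] by simp
  then have "b v u = b u v" by simp
  ultimately show ?thesis by simp
qed

text \<open>If both forms were nonzero, vectors \<open>u\<close>, \<open>v\<close> with
  \<open>f u u\<close> and \<open>g v v\<close> nonzero would exist. Along \<open>a * v + u\<close>
  the two diagonals are polynomials in real \<open>a\<close> with few roots, so their product cannot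
  vanish throughout.\<close>

lemma sesq_product_zero:
  assumes f: "sesq f" and g: "sesq g" and z: "\<And>v. v \<in> L2 \<Longrightarrow> f v v = 0 \<or> g v v = 0"
  shows "(\<forall>u\<in>L2. \<forall>v\<in>L2. f u v = 0) \<or> (\<forall>u\<in>L2. \<forall>v\<in>L2. g u v = 0)"
proof (rule ccontr)
  assume "\<not> ?thesis"
  then obtain u v where uv: "u \<in> L2" "v \<in> L2" "f u u \<noteq> 0" "g v v \<noteq> 0"
    using sesq_zero[OF f] sesq_zero[OF g] by metis
  have 0: "g u u = 0" "f v v = 0" using z uv by auto
  define F where "F = f v u + f u v"
  define G where "G = g v u + g u v"
  \<comment> \<open>As \<open>f v v = 0\<close>, the first diagonal is affine in \<open>a\<close>;
    as \<open>g u u = 0\<close>, the second has a factor \<open>a\<close>, which is cancelled. Each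
    remaining affine factor has at most one root, so three nonzero values of \<open>a\<close> are
    too many.\<close>
  have *: "f u u + a * F = 0 \<or> G + a * g v v = 0" if a: "a \<in> {1, 2, 3}" for a :: complex
  proof -
    have "cnj a = a" "a \<noteq> 0" using a by auto
    have "f u u + a * F = 0 \<or> a * (G + a * g v v) = 0"
      using z[OF L2_lincomb[OF uv(2,1), of a]] 0 \<open>cnj a = a\<close>
      unfolding sesq_quadratic[OF f uv(1,2)] sesq_quadratic[OF g uv(1,2)] F_def G_def
      by (simp add: algebra_simps)
    then show ?thesis using \<open>a \<noteq> 0\<close> by simp
  qed
  have f1: "a = b" if "f u u + a * F = 0" "f u u + b * F = 0" for a b
  proof -
    have "F \<noteq> 0" using that uv(3) by auto
    moreover have "(a - b) * F = (f u u + a * F) - (f u u + b * F)" by (simp add: algebra_simps)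
    then have "(a - b) * F = 0" using that by simp
    ultimately show ?thesis by simp
  qed
  have g1: "a = b" if "G + a * g v v = 0" "G + b * g v v = 0" for a b
  proof -
    have "(a - b) * g v v = (G + a * g v v) - (G + b * g v v)" by (simp add: algebra_simps)
    then have "(a - b) * g v v = 0" using that by simp
    then show ?thesis using uv(4) by simp
  qed
  show False
    using *[of 1] *[of 2] *[of 3] f1[of 1 2] f1[of 1 3] f1[of 2 3] g1[of 1 2] g1[of 1 3] g1[of 2 3]
    by auto
qed

text \<open>A polynomial of degree at most 4 is determined by its values at 0, 1, -1, 2 and
  -2.\<close>

lemma quartic_coeffs:
  fixes a0 :: real
  assumes "\<And>t. a0 + a1 * t + a2 * t^2 + a3 * t^3 + a4 * t^4 = b0 + b1 * t + b2 * t^2 + b3 * t^3 + b4 * t^4"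
  shows "a1 = b1 \<and> a2 = b2 \<and> a4 = b4"
  using assms[of 0] assms[of 1] assms[of "-1"] assms[of 2] assms[of "-2"] by (simp add: power_numeral_reduce)

text \<open>On each real line \<open>a = t * s\<close> the squared modulus is a quartic in
  \<open>t\<close>. Comparing coefficients determines \<open>cmod p ^ 2 + cmod q ^ 2\<close>, hence
  \<open>Re r\<close>, and also \<open>cmod r\<close>; this fixes \<open>r\<close> up to
  conjugation.\<close>

lemma cmod_quadratic_eq:
  fixes p q r p' q' r' :: complex
  assumes eq: "\<And>a. cmod (1 + a * p + cnj a * q + a * cnj a * r) =
                   cmod (1 + a * p' + cnj a * q' + a * cnj a * r')"
  shows "r = r' \<or> r = cnj r'"
proof -
  have expand: "(cmod (1 + of_real t * z + (of_real t)\<^sup>2 * w))\<^sup>2 =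
      1 + (2 * Re z) * t + ((cmod z)\<^sup>2 + 2 * Re w) * t^2 + (2 * Re (z * cnj w)) * t^3 + (cmod w)\<^sup>2 * t^4"
    for t z w
    unfolding cmod_power2 by (simp add: power2_eq_square power3_eq_cube power4_eq_xxxx algebra_simps)
  have c: "2 * Re (s * p + cnj s * q) = 2 * Re (s * p' + cnj s * q') \<and>
      (cmod (s * p + cnj s * q))\<^sup>2 + 2 * Re (s * cnj s * r) =
      (cmod (s * p' + cnj s * q'))\<^sup>2 + 2 * Re (s * cnj s * r') \<and>
      (cmod (s * cnj s * r))\<^sup>2 = (cmod (s * cnj s * r'))\<^sup>2" for s
  proof (rule quartic_coeffs)
    fix t
    have "(cmod (1 + of_real t * (s * p + cnj s * q) + (of_real t)\<^sup>2 * (s * cnj s * r)))\<^sup>2 =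
        (cmod (1 + of_real t * (s * p' + cnj s * q') + (of_real t)\<^sup>2 * (s * cnj s * r')))\<^sup>2"
      using eq[of "of_real t * s"] by (simp add: algebra_simps power2_eq_square)
    then show "1 + (2 * Re (s * p + cnj s * q)) * t +
      ((cmod (s * p + cnj s * q))\<^sup>2 + 2 * Re (s * cnj s * r)) * t^2 +
      (2 * Re ((s * p + cnj s * q) * cnj (s * cnj s * r))) * t^3 + (cmod (s * cnj s * r))\<^sup>2 * t^4 =
      1 + (2 * Re (s * p' + cnj s * q')) * t +
      ((cmod (s * p' + cnj s * q'))\<^sup>2 + 2 * Re (s * cnj s * r')) * t^2 +
      (2 * Re ((s * p' + cnj s * q') * cnj (s * cnj s * r'))) * t^3 + (cmod (s * cnj s * r'))\<^sup>2 * t^4"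
      unfolding expand .
  qed
  \<comment> \<open>The directions 1 and \<open>\<i>\<close> give \<open>p + cnj q\<close>; the sum
    of their quadratic coefficients gives \<open>n\<close> and the difference gives the real part of
    \<open>p * cnj q\<close>. The direction \<open>1 + \<i>\<close> supplies its imaginary
    part.\<close>
  note c1 = c[of 1] and c2 = c[of \<i>] and c3 = c[of "1 + \<i>"]
  have n: "(cmod p)\<^sup>2 + (cmod q)\<^sup>2 + 2 * Re r = (cmod p')\<^sup>2 + (cmod q')\<^sup>2 + 2 * Re r'"
    using c1 c2 unfolding cmod_power2 by (simp add: power2_eq_square algebra_simps)
  have P: "p * cnj q = p' * cnj q'"
    using c1 c2 c3 unfolding cmod_power2 complex_eq_iff by (simp add: power2_eq_square algebra_simps)
  have S: "p + cnj q = p' + cnj q'"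
    using c1 c2 by (simp add: complex_eq_iff)
  \<comment> \<open>\<open>p\<close>, \<open>cnj q\<close> and \<open>p'\<close>, \<open>cnj q'\<close> are the roots of the same quadratic polynomial.\<close>
  have "(p - p') * (p - cnj q') = p * p - (p' + cnj q') * p + p' * cnj q'"
    by (simp add: algebra_simps)
  also have "\<dots> = 0" unfolding S[symmetric] P[symmetric] by (simp add: algebra_simps)
  finally have "p = p' \<or> p = cnj q'" by simp
  then have "(cmod p)\<^sup>2 + (cmod q)\<^sup>2 = (cmod p')\<^sup>2 + (cmod q')\<^sup>2"
  proof
    assume "p = p'"
    then show ?thesis using S by simp
  next
    assume *: "p = cnj q'"
    then have "cnj q = p'" using S by simp
    then have "q = cnj p'" by auto
    then show ?thesis using * by simp
  qed
  then have re: "Re r = Re r'" using n by simp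
  moreover have "(cmod r)\<^sup>2 = (cmod r')\<^sup>2" using c1 by simp
  then have "(Im r)\<^sup>2 = (Im r')\<^sup>2" using re by (simp add: cmod_power2)
  ultimately show ?thesis by (auto simp: power2_eq_iff complex_eq_iff)
qed

text \<open>Both forms are scaled to be 1 at a common vector \<open>u\<close>. Moving from
  \<open>u\<close> in direction \<open>v\<close> shows that the diagonals at \<open>v\<close> are
  equal or conjugate, and \<open>sesq_product_zero\<close> makes the alternative independent of
  \<open>v\<close>.\<close>

lemma sesq_cmod_eq:
  assumes b: "sesq b" and w: "sesq w"
    and eq: "\<And>u. u \<in> L2 \<Longrightarrow> cmod (b u u) = cmod (w u u)"
    and nz: "u0 \<in> L2" "v0 \<in> L2" "w u0 v0 \<noteq> 0"
  shows "\<exists>c. cmod c = 1 \<and> ((\<forall>u\<in>L2. \<forall>v\<in>L2. b u v = c * w u v) \<or>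
    (\<forall>u\<in>L2. \<forall>v\<in>L2. b u v = c * cnj (w v u)))"
proof -
  obtain u where u: "u \<in> L2" "w u u \<noteq> 0"
    using sesq_zero[OF w] nz by blast
  define \<beta> where "\<beta> = b u u"
  define \<omega> where "\<omega> = w u u"
  have nz1: "cmod \<beta> = cmod \<omega>" "\<omega> \<noteq> 0" "\<beta> \<noteq> 0" using u eq[OF u(1)] by (auto simp: \<beta>_def \<omega>_def)
  define b1 where "b1 u v = inverse \<beta> * b u v" for u v
  define w1 where "w1 u v = inverse \<omega> * w u v" for u v
  have s1: "sesq b1" "sesq w1" unfolding b1_def w1_def by (intro sesq_scale b w)+
  have uu: "b1 u u = 1" "w1 u u = 1" using nz1 by (auto simp: b1_def w1_def \<beta>_def \<omega>_def)
  have eq1: "cmod (b1 v v) = cmod (w1 v v)" if "v \<in> L2" for v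
    using eq[OF that] nz1 by (simp add: b1_def w1_def norm_mult norm_inverse)
  have "b1 v v - w1 v v = 0 \<or> b1 v v - cnj (w1 v v) = 0" if v: "v \<in> L2" for v
  proof -
    have "b1 v v = w1 v v \<or> b1 v v = cnj (w1 v v)"
    proof (rule cmod_quadratic_eq)
      fix a
      show "cmod (1 + a * b1 v u + cnj a * b1 u v + a * cnj a * b1 v v) =
            cmod (1 + a * w1 v u + cnj a * w1 u v + a * cnj a * w1 v v)"
        using eq1[OF L2_lincomb[OF v u(1), of a]] unfolding sesq_quadratic[OF s1(1) u(1) v] sesq_quadratic[OF s1(2) u(1) v] uu .
    qed
    then show ?thesis by auto
  qed
  from sesq_product_zero[OF sesq_diff[OF s1] sesq_diff[OF s1(1) sesq_cnj[OF s1(2)]], OF this]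
  show ?thesis
  proof
    assume *: "\<forall>u\<in>L2. \<forall>v\<in>L2. b1 u v - w1 u v = 0"
    show ?thesis
    proof (intro exI conjI disjI1 ballI)
      fix u v assume "u \<in> L2" "v \<in> L2"
      then show "b u v = (\<beta> / \<omega>) * w u v" using * nz1 by (auto simp: b1_def w1_def field_simps)
    qed (use nz1 in \<open>simp add: norm_divide\<close>)
  next
    assume *: "\<forall>u\<in>L2. \<forall>v\<in>L2. b1 u v - cnj (w1 v u) = 0"
    show ?thesis
    proof (intro exI conjI disjI2 ballI)
      fix u v assume "u \<in> L2" "v \<in> L2"
      then show "b u v = (\<beta> / cnj \<omega>) * cnj (w v u)" using * nz1 by (auto simp: b1_def w1_def field_simps)
    qed (use nz1 in \<open>simp add: norm_divide\<close>)
  qed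
qed

section \<open>Phase space shifts\<close>

definition weyl :: "real \<Rightarrow> real \<Rightarrow> (real \<Rightarrow> complex) \<Rightarrow> real \<Rightarrow> complex" where
  "weyl x y u t = exp (- (\<i> * of_real y * of_real t)) * u (t - x)"

lemma ambiguity_eq_ip: "ambiguity u x y = ip u (weyl x y u)"
  by (simp add: ambiguity_def ip_def weyl_def exp_cnj mult_ac)

lemma weyl_zero: "weyl 0 0 u = u"
  by (simp add: weyl_def fun_eq_iff)

lemma weyl_lincomb: "weyl x y (\<lambda>t. a * u t + v t) = (\<lambda>t. a * weyl x y u t + weyl x y v t)"
  by (simp add: weyl_def fun_eq_iff algebra_simps)

lemma weyl_scale: "weyl x y (\<lambda>t. a * u t) = (\<lambda>t. a * weyl x y u t)"
  by (simp add: weyl_def fun_eq_iff algebra_simps)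

lemma weyl_weyl:
  "weyl x y (weyl x' y' u) = (\<lambda>t. exp (\<i> * of_real (x * y')) * weyl (x + x') (y + y') u t)"
proof
  fix t
  have "exp (- (\<i> * of_real y * of_real t)) * exp (- (\<i> * of_real y' * of_real (t - x))) =
    exp (\<i> * of_real (x * y')) * exp (- (\<i> * of_real (y + y') * of_real t))"
    by (simp add: exp_add[symmetric] algebra_simps)
  then show "weyl x y (weyl x' y' u) t = exp (\<i> * of_real (x * y')) * weyl (x + x') (y + y') u t"
    by (simp only: weyl_def mult.assoc[symmetric] diff_diff_eq)
qed

text \<open>The Weyl commutation relation; the exponent is the symplectic form of
  \<open>(x, y)\<close> and \<open>(x', y')\<close>.\<close>

lemma weyl_commute:
  "weyl x y (weyl x' y' u) = (\<lambda>t. exp (\<i> * of_real (x * y' - x' * y)) * weyl x' y' (weyl x y u) t)"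
proof -
  have "exp (\<i> * of_real (x * y' - x' * y)) * exp (\<i> * of_real (x' * y)) = exp (\<i> * of_real (x * y'))"
    by (simp add: exp_add[symmetric] algebra_simps)
  then show ?thesis
    by (simp only: weyl_weyl mult.assoc[symmetric] add.commute[of x' x] add.commute[of y' y])
qed

lemma weyl_inverse: "weyl x y (weyl (-x) (-y) u) = (\<lambda>t. exp (- (\<i> * of_real (x * y))) * u t)"
  by (simp add: weyl_weyl weyl_zero)

lemma cmod_exp_i: "cmod (exp (\<i> * of_real r)) = 1" "cmod (exp (- (\<i> * of_real r))) = 1"
  by simp_all

lemma weyl_L2:
  assumes "u \<in> L2"
  shows "weyl x y u \<in> L2"
proof -
  have *: "(\<lambda>t. u (t - x)) \<in> L2" using L2_affine[OF assms, of 1 "-x"] by simp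
  have [measurable]: "u \<in> borel_measurable borel" using assms by (rule L2_measurable)
  show ?thesis using * by (simp add: L2_def weyl_def[abs_def] norm_mult)
qed

lemma weyl_cong:
  assumes "L2_eq u v" "u \<in> L2" "v \<in> L2"
  shows "L2_eq (weyl x y u) (weyl x y v)"
  using L2_eq_affine[OF assms, of 1 "-x"] by (auto simp: L2_eq_def weyl_def elim: eventually_mono)

lemma ip_weyl_weyl: "ip (weyl x y u) (weyl x y v) = ip u v"
proof -
  have "weyl x y u t * cnj (weyl x y v t) = u (t - x) * cnj (v (t - x))" for t
    by (simp add: weyl_def exp_cnj algebra_simps) (simp add: exp_minus mult.assoc[symmetric] )
  then have "ip (weyl x y u) (weyl x y v) = (LINT t|lborel. u (- x + 1 * t) * cnj (v (- x + 1 * t)))"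
    by (simp add: ip_def)
  also have "\<dots> = ip u v"
    unfolding ip_def
    using lborel_integral_real_affine[of 1 "\<lambda>t. u t * cnj (v t)" "-x"] by simp
  finally show ?thesis .
qed

lemma sesq_ip_weyl: "sesq (\<lambda>u v. ip u (weyl x y v))"
  by (simp add: sesq_def weyl_lincomb ip_lincomb_left ip_lincomb_right weyl_L2)

section \<open>Reflection and symmetries of the ambiguity function\<close>

definition reflect :: "(real \<Rightarrow> complex) \<Rightarrow> real \<Rightarrow> complex" where
  "reflect u t = u (- t)"

lemma reflect_reflect: "reflect (reflect u) = u"
  by (simp add: reflect_def fun_eq_iff)

lemma reflect_L2: "u \<in> L2 \<Longrightarrow> reflect u \<in> L2"
  using L2_affine[of u "-1" 0] by (simp add: reflect_def[abs_def])

lemma reflect_weyl: "reflect (weyl x y u) = weyl (-x) (-y) (reflect u)"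
  by (simp add: reflect_def weyl_def fun_eq_iff)

lemma ip_reflect: "ip (reflect u) (reflect v) = ip u v"
  using lborel_integral_real_affine[of "-1" "\<lambda>t. u t * cnj (v t)" 0] by (simp add: ip_def reflect_def)

lemma ambiguity_reflect: "ambiguity (reflect u) x y = ambiguity u (-x) (-y)"
  unfolding ambiguity_eq_ip using reflect_weyl[of "-x" "-y" u] ip_reflect[of u "weyl (-x) (-y) u"] by simp

lemma ambiguity_scale: "ambiguity (\<lambda>t. c * u t) x y = (cmod c)\<^sup>2 * ambiguity u x y"
  using complex_norm_square[of c]
  by (simp add: ambiguity_eq_ip weyl_scale ip_scale_left ip_scale_right)

lemma ambiguity_weyl: "ambiguity (weyl a b u) x y = exp (\<i> * of_real (a * y - b * x)) * ambiguity u x y"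
proof -
  have *: "weyl x y (weyl a b u) = (\<lambda>t. exp (\<i> * of_real (x * b - a * y)) * weyl a b (weyl x y u) t)"
    by (rule weyl_commute)
  show ?thesis
    unfolding ambiguity_eq_ip * ip_scale_right ip_weyl_weyl by (simp add: exp_cnj algebra_simps)
qed

lemma ambiguity_cnj: "cmod (ambiguity (\<lambda>t. cnj (u t)) x y) = cmod (ambiguity u x (-y))"
proof -
  have "ambiguity (\<lambda>t. cnj (u t)) x y = cnj (ambiguity u x (-y))"
    unfolding ambiguity_def
    by (subst Bochner_Integration.integral_cnj[symmetric]) (simp add: exp_cnj)
  then show ?thesis by simp
qed

lemma ambiguity_cong:
  assumes "L2_eq u v" "u \<in> L2" "v \<in> L2"
  shows "ambiguity u x y = ambiguity v x y"
  unfolding ambiguity_eq_ip using assms by (intro ip_cong weyl_cong weyl_L2)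

text \<open>Shifting both arguments of the inner product by \<open>(x, y)\<close> turns the opposite
  shift into a phase and leaves the conjugate of the ambiguity function.\<close>

lemma ambiguity_uminus: "cmod (ambiguity u (-x) (-y)) = cmod (ambiguity u x y)"
proof -
  have "ip u (weyl (-x) (-y) u) = ip (weyl x y u) (weyl x y (weyl (-x) (-y) u))"
    by (simp only: ip_weyl_weyl)
  also have "\<dots> = cnj (exp (- (\<i> * of_real (x * y)))) * cnj (ip u (weyl x y u))"
    by (simp only: weyl_inverse ip_scale_right) (metis ip_cnj)
  finally show ?thesis
    using cmod_exp_i(2)[of "x * y"] by (simp only: ambiguity_eq_ip norm_mult complex_mod_cnj)
qed

text \<open>The order of the shifts is preserved, so applying this to both orders compares the
  commutation phases on the two sides of \<open>S\<close>.\<close>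

lemma weyl_weyl_intertwine:
  assumes S: "\<And>u. u \<in> L2 \<Longrightarrow> S u \<in> L2"
    and A: "\<And>u. u \<in> L2 \<Longrightarrow> L2_eq (weyl x y (S u)) (\<lambda>t. a * S (weyl p q u) t)"
    and B: "\<And>u. u \<in> L2 \<Longrightarrow> L2_eq (weyl x' y' (S u)) (\<lambda>t. b * S (weyl p' q' u) t)"
    and u: "u \<in> L2"
  shows "L2_eq (weyl x y (weyl x' y' (S u))) (\<lambda>t. b * a * S (weyl p q (weyl p' q' u)) t)"
proof -
  have "L2_eq (weyl x y (weyl x' y' (S u))) (weyl x y (\<lambda>t. b * S (weyl p' q' u) t))"
    using u by (intro weyl_cong B) (auto intro!: weyl_L2 L2_scale S)
  also have "weyl x y (\<lambda>t. b * S (weyl p' q' u) t) = (\<lambda>t. b * weyl x y (S (weyl p' q' u)) t)"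
    by (rule weyl_scale)
  also have "L2_eq \<dots> (\<lambda>t. b * (a * S (weyl p q (weyl p' q' u)) t))"
    using u by (intro L2_eq_scale A weyl_L2)
  finally show ?thesis by (simp only: mult.assoc)
qed

section \<open>Intertwining relations of an ambiguity-preserving operator\<close>

text \<open>The sign \<open>e = -1\<close> accounts for an antilinear operator composed with complex conjugation.\<close>

locale ambiguity_preserver =
  fixes T :: "(real \<Rightarrow> complex) \<Rightarrow> real \<Rightarrow> complex" and e :: real
  assumes map: "L2_map T" and lin: "L2_linear T" and e: "e \<in> {1, -1}"
    and amb: "\<And>u x y. u \<in> L2 \<Longrightarrow> cmod (ambiguity (T u) x y) = cmod (ambiguity u x (e * y))"
begin

lemma T_L2: "u \<in> L2 \<Longrightarrow> T u \<in> L2"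
  using map by (simp add: L2_map_def)

lemma T_scale: "u \<in> L2 \<Longrightarrow> L2_eq (T (\<lambda>t. a * u t)) (\<lambda>t. a * T u t)"
  using lin by (simp add: L2_linear_def)

lemma T_lincomb:
  assumes "u \<in> L2" "v \<in> L2"
  shows "L2_eq (T (\<lambda>t. a * u t + v t)) (\<lambda>t. a * T u t + T v t)"
proof -
  have "L2_eq (T (\<lambda>t. a * u t + v t)) (\<lambda>t. T (\<lambda>t. a * u t) t + T v t)"
    using lin assms by (simp add: L2_linear_def L2_additive_def L2_scale)
  also have "L2_eq \<dots> (\<lambda>t. a * T u t + T v t)"
    using T_scale[OF assms(1), of a] by (auto simp: L2_eq_def elim: eventually_mono)
  finally show ?thesis .
qed

lemma sesq_T: "sesq (\<lambda>u v. ip (T u) (weyl x y (T v)))"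
  unfolding sesq_def
proof (intro ballI allI conjI)
  fix u v w a assume uvw: "u \<in> L2" "v \<in> L2" "w \<in> L2"
  note L = uvw T_L2 weyl_L2 L2_lincomb
  have "ip (T (\<lambda>t. a * u t + v t)) (weyl x y (T w)) = ip (\<lambda>t. a * T u t + T v t) (weyl x y (T w))"
    by (intro ip_cong T_lincomb L2_eq_refl L)
  then show "ip (T (\<lambda>t. a * u t + v t)) (weyl x y (T w)) =
      a * ip (T u) (weyl x y (T w)) + ip (T v) (weyl x y (T w))"
    by (simp add: ip_lincomb_left L)
  have "ip (T w) (weyl x y (T (\<lambda>t. a * u t + v t))) = ip (T w) (weyl x y (\<lambda>t. a * T u t + T v t))"
    by (intro ip_cong T_lincomb weyl_cong L2_eq_refl L)
  then show "ip (T w) (weyl x y (T (\<lambda>t. a * u t + v t))) =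
      cnj a * ip (T w) (weyl x y (T u)) + ip (T w) (weyl x y (T v))"
    by (simp add: weyl_lincomb ip_lincomb_right L)
qed

text \<open>At the origin the ambiguity function is the squared norm; polarization does the
  rest.\<close>

lemma T_isometry:
  assumes "u \<in> L2" "v \<in> L2"
  shows "ip (T u) (T v) = ip u v"
proof -
  have "sesq (\<lambda>u v. ip (T u) (T v) - ip u v)"
    using sesq_diff[OF sesq_T[of 0 0] sesq_ip_weyl[of 0 0]] by (simp add: weyl_zero)
  moreover have "ip (T u) (T u) - ip u u = 0" if "u \<in> L2" for u
    using amb[OF that, of 0 0] by (simp add: ambiguity_eq_ip weyl_zero ip_self)
  ultimately have "ip (T u) (T v) - ip u v = 0" using assms by (rule sesq_zero)
  then show ?thesis by simp
qed

text \<open>The sign \<open>s\<close> records the alternative of \<open>sesq_cmod_eq\<close> at this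
  point: 1 for the form itself, -1 for its adjoint.\<close>

definition intertwines :: "real \<Rightarrow> real \<Rightarrow> real \<Rightarrow> bool" where
  "intertwines x y s \<longleftrightarrow> (\<exists>c. cmod c = 1 \<and>
     (\<forall>u\<in>L2. L2_eq (weyl x y (T u)) (\<lambda>t. c * T (weyl (s * x) (s * e * y) u) t)))"

lemma intertwines_exists: "\<exists>s\<in>{1,-1}. intertwines x y s"
proof -
  note L = T_L2 weyl_L2 L2_scale
  obtain w where w: "w \<in> L2" "ip w w \<noteq> 0" using L2_nontrivial by blast
  have "\<exists>c. cmod c = 1 \<and>
    ((\<forall>u\<in>L2. \<forall>v\<in>L2. ip (T u) (weyl x y (T v)) = c * ip u (weyl x (e * y) v)) \<or>
     (\<forall>u\<in>L2. \<forall>v\<in>L2. ip (T u) (weyl x y (T v)) = c * cnj (ip v (weyl x (e * y) u))))"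
    by (rule sesq_cmod_eq[OF sesq_T sesq_ip_weyl, of x y x "e * y" "weyl x (e * y) w" w])
       (use w amb in \<open>auto simp: ambiguity_eq_ip ip_weyl_weyl weyl_L2\<close>)
  then obtain c where c: "cmod c = 1"
    and alt: "(\<forall>u\<in>L2. \<forall>v\<in>L2. ip (T u) (weyl x y (T v)) = c * ip u (weyl x (e * y) v)) \<or>
     (\<forall>u\<in>L2. \<forall>v\<in>L2. ip (T u) (weyl x y (T v)) = c * cnj (ip v (weyl x (e * y) u)))"
    by blast
  have cc: "c * cnj c = 1" "cnj c * c = 1"
    using c complex_norm_square[of c] by (auto simp: mult.commute)
  from alt show ?thesis
  proof
    \<comment> \<open>Testing against the image of the shifted vector gives an inner product of
      maximal modulus, which forces equality up to \<open>cnj c\<close>.\<close>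
    assume *: "\<forall>u\<in>L2. \<forall>v\<in>L2. ip (T u) (weyl x y (T v)) = c * ip u (weyl x (e * y) v)"
    have "L2_eq (weyl x y (T u)) (\<lambda>t. cnj c * T (weyl x (e * y) u) t)" if u: "u \<in> L2" for u
    proof (rule L2_eq_if_ip)
      have 1: "ip (T (weyl x (e * y) u)) (weyl x y (T u)) = c * ip u u"
        using * u by (simp add: L ip_weyl_weyl)
      have 2: "ip (weyl x y (T u)) (T (weyl x (e * y) u)) = cnj c * ip u u"
        by (subst ip_cnj) (simp add: 1 ip_cnj[of u u, symmetric])
      show "ip (weyl x y (T u)) (weyl x y (T u)) =
        ip (\<lambda>t. cnj c * T (weyl x (e * y) u) t) (\<lambda>t. cnj c * T (weyl x (e * y) u) t)"
        using u cc by (simp add: ip_scale_left ip_scale_right T_isometry L ip_weyl_weyl mult.assoc[symmetric])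
      show "ip (weyl x y (T u)) (\<lambda>t. cnj c * T (weyl x (e * y) u) t) =
        ip (\<lambda>t. cnj c * T (weyl x (e * y) u) t) (\<lambda>t. cnj c * T (weyl x (e * y) u) t)"
        using u by (simp add: ip_scale_left ip_scale_right T_isometry L ip_weyl_weyl 2)
    qed (use u in \<open>auto intro!: L\<close>)
    then have "intertwines x y 1"
      unfolding intertwines_def using c by (intro exI[of _ "cnj c"]) simp
    then show ?thesis by blast
  next
    \<comment> \<open>Here the same test shows that \<open>T\<close> between two shifts is
      \<open>T\<close> up to \<open>cnj c\<close>. Replacing \<open>u\<close> by its inverse shift,
      which costs the phase \<open>p\<close>, moves one shift across and produces the sign
      -1.\<close>
    assume *: "\<forall>u\<in>L2. \<forall>v\<in>L2. ip (T u) (weyl x y (T v)) = c * cnj (ip v (weyl x (e * y) u))"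
    have 0: "L2_eq (weyl x y (T (weyl x (e * y) u))) (\<lambda>t. cnj c * T u t)" if u: "u \<in> L2" for u
    proof (rule L2_eq_if_ip)
      have 1: "ip (T u) (weyl x y (T (weyl x (e * y) u))) = c * ip u u"
        using * u by (simp add: L ip_weyl_weyl ip_cnj[of u u, symmetric])
      have 2: "ip (weyl x y (T (weyl x (e * y) u))) (T u) = cnj c * ip u u"
        by (subst ip_cnj) (simp add: 1 ip_cnj[of u u, symmetric])
      show "ip (weyl x y (T (weyl x (e * y) u))) (weyl x y (T (weyl x (e * y) u))) =
        ip (\<lambda>t. cnj c * T u t) (\<lambda>t. cnj c * T u t)"
        using u cc by (simp add: ip_scale_left ip_scale_right T_isometry L ip_weyl_weyl mult.assoc[symmetric])
      show "ip (weyl x y (T (weyl x (e * y) u))) (\<lambda>t. cnj c * T u t) =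
        ip (\<lambda>t. cnj c * T u t) (\<lambda>t. cnj c * T u t)"
        using u by (simp add: ip_scale_left ip_scale_right T_isometry L 2)
    qed (use u in \<open>auto intro!: L\<close>)
    define p where "p = exp (- (\<i> * of_real (x * (e * y))))"
    have p: "cmod p = 1" "p \<noteq> 0" by (auto simp: p_def)
    have "L2_eq (weyl x y (T u)) (\<lambda>t. (inverse p * cnj c) * T (weyl (-x) (- (e * y)) u) t)"
      if u: "u \<in> L2" for u
    proof -
      have "L2_eq (weyl x y (\<lambda>t. p * T u t)) (weyl x y (T (\<lambda>t. p * u t)))"
        using u by (intro weyl_cong L2_eq_sym[OF T_scale] L)
      also have "(\<lambda>t. p * u t) = weyl x (e * y) (weyl (-x) (- (e * y)) u)"
        by (simp only: weyl_inverse p_def)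
      also have "L2_eq (weyl x y (T \<dots>)) (\<lambda>t. cnj c * T (weyl (-x) (- (e * y)) u) t)"
        using u by (intro 0 L)
      finally show ?thesis
        unfolding weyl_scale L2_eq_def by (rule eventually_mono) (use p in \<open>auto simp: field_simps\<close>)
    qed
    then have "intertwines x y (-1)"
      unfolding intertwines_def using c p
      by (intro exI[of _ "inverse p * cnj c"]) (simp add: norm_mult norm_inverse)
    then show ?thesis by blast
  qed
qed

text \<open>Exchanging the two shifts multiplies by \<open>exp (\<i> * \<sigma>)\<close> before
  \<open>T\<close> is passed and by \<open>exp (\<i> * s * s' * e * \<sigma>)\<close> after.
  Opposite exponents would give \<open>sin \<sigma> = 0\<close>, which is excluded for nonzero
  \<open>\<sigma>\<close> of modulus at most 1.\<close>

lemma intertwines_sign: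
  assumes A: "intertwines x y s" and B: "intertwines x' y' s'" and s: "s \<in> {1,-1}" "s' \<in> {1,-1}"
    and \<sigma>: "x * y' - x' * y \<noteq> 0" "\<bar>x * y' - x' * y\<bar> \<le> 1"
  shows "s * s' * e = 1"
proof (rule ccontr)
  assume "s * s' * e \<noteq> 1"
  then have m: "s * s' * e = -1" using s e by auto
  define \<sigma> where "\<sigma> = x * y' - x' * y"
  obtain c where c: "cmod c = 1"
    and cT: "\<And>u. u \<in> L2 \<Longrightarrow> L2_eq (weyl x y (T u)) (\<lambda>t. c * T (weyl (s * x) (s * e * y) u) t)"
    using A unfolding intertwines_def by blast
  obtain d where d: "cmod d = 1"
    and dT: "\<And>u. u \<in> L2 \<Longrightarrow> L2_eq (weyl x' y' (T u)) (\<lambda>t. d * T (weyl (s' * x') (s' * e * y') u) t)"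
    using B unfolding intertwines_def by blast
  obtain u where u: "u \<in> L2" "ip u u \<noteq> 0" using L2_nontrivial by blast
  define v where "v = weyl (s' * x') (s' * e * y') (weyl (s * x) (s * e * y) u)"
  have v: "v \<in> L2" "ip v v \<noteq> 0" using u by (auto simp: v_def weyl_L2 ip_weyl_weyl)
  have cm: "weyl (s * x) (s * e * y) (weyl (s' * x') (s' * e * y') u) = (\<lambda>t. exp (- (\<i> * of_real \<sigma>)) * v t)"
  proof -
    have "(s * x) * (s' * e * y') - (s' * x') * (s * e * y) = (s * s' * e) * \<sigma>"
      by (simp add: \<sigma>_def algebra_simps)
    also have "\<dots> = - \<sigma>" using m by simp
    finally show ?thesis by (subst weyl_commute) (simp add: v_def)
  qed
  have "L2_eq (\<lambda>t. exp (\<i> * of_real \<sigma>) * (c * d * T v t))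
              (\<lambda>t. exp (\<i> * of_real \<sigma>) * weyl x' y' (weyl x y (T u)) t)"
    unfolding v_def using u
    by (intro L2_eq_scale L2_eq_sym[OF weyl_weyl_intertwine[of T]] cT dT T_L2)
  also have "(\<lambda>t. exp (\<i> * of_real \<sigma>) * weyl x' y' (weyl x y (T u)) t) = weyl x y (weyl x' y' (T u))"
    unfolding \<sigma>_def by (rule weyl_commute[symmetric])
  also have "L2_eq \<dots> (\<lambda>t. d * c * T (\<lambda>t. exp (- (\<i> * of_real \<sigma>)) * v t) t)"
    unfolding cm[symmetric] using u by (intro weyl_weyl_intertwine[of T] cT dT T_L2)
  also have "L2_eq \<dots> (\<lambda>t. d * c * (exp (- (\<i> * of_real \<sigma>)) * T v t))"
    using v by (intro L2_eq_scale T_scale)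
  finally have *: "L2_eq (\<lambda>t. exp (\<i> * of_real \<sigma>) * (c * d * T v t))
      (\<lambda>t. d * c * (exp (- (\<i> * of_real \<sigma>)) * T v t))" .
  \<comment> \<open>Pairing with \<open>T v\<close> extracts the scalars, because
    \<open>ip (T v) (T v) = ip v v\<close> is nonzero.\<close>
  have "ip (\<lambda>t. exp (\<i> * of_real \<sigma>) * (c * d * T v t)) (T v) =
      ip (\<lambda>t. d * c * (exp (- (\<i> * of_real \<sigma>)) * T v t)) (T v)"
    using v by (intro ip_cong * L2_eq_refl L2_scale T_L2)
  then have "exp (\<i> * of_real \<sigma>) = exp (- (\<i> * of_real \<sigma>))"
    using v c d by (auto simp: ip_scale_left T_isometry)
  then have "exp (\<i> * of_real \<sigma>) = cnj (exp (\<i> * of_real \<sigma>))" by (simp add: exp_cnj)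
  then have "Im (exp (\<i> * of_real \<sigma>)) = 0" by (metis Reals_cnj_iff complex_is_Real_iff)
  then have "sin \<sigma> = 0" by (simp add: Im_exp)
  moreover have "\<sigma> \<noteq> 0" "\<bar>\<sigma>\<bar> < pi" using \<sigma> pi_gt3 by (auto simp: \<sigma>_def)
  ultimately show False
    using sin_gt_zero[of \<sigma>] sin_gt_zero[of "-\<sigma>"] by (cases "\<sigma> > 0") (auto simp: abs_less_iff)
qed

text \<open>The points (1,0), (0,1) and (1,1) have pairwise symplectic form 1 or -1. For
  \<open>e = -1\<close> their three signs would be pairwise different.\<close>

lemma e_eq_1: "e = 1"
proof (rule ccontr)
  assume "e \<noteq> 1"
  then have e1: "e = -1" using e by simp
  obtain s1 where s1: "s1 \<in> {1,-1}" "intertwines 1 0 s1" using intertwines_exists by blast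
  obtain s2 where s2: "s2 \<in> {1,-1}" "intertwines 0 1 s2" using intertwines_exists by blast
  obtain s3 where s3: "s3 \<in> {1,-1}" "intertwines 1 1 s3" using intertwines_exists by blast
  show False
    using intertwines_sign[OF s1(2) s2(2) s1(1) s2(1)] intertwines_sign[OF s1(2) s3(2) s1(1) s3(1)]
      intertwines_sign[OF s2(2) s3(2) s2(1) s3(1)] s1(1) s2(1) s3(1) e1
    by auto
qed

text \<open>With \<open>e = 1\<close> the sign passes between any two points whose symplectic form
  is nonzero and at most 1 in modulus. It travels from (1,0) over short modulations to all
  translations, and over short translations to all modulations.\<close>

lemma intertwines_uniform: "\<exists>s\<in>{1,-1}. (\<forall>x. intertwines x 0 s) \<and> (\<forall>y. intertwines 0 y s)"
proof -
  obtain s where s: "s \<in> {1,-1}" "intertwines 1 0 s" using intertwines_exists by blast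
  \<comment> \<open>The origin has symplectic form 0 with every point, so the sign cannot be passed
    to it; the identity shift admits either sign.\<close>
  have zero: "intertwines 0 0 s"
    unfolding intertwines_def by (intro exI[of _ 1]) (simp add: weyl_zero L2_eq_refl)
  have same: "intertwines x' y' s"
    if "intertwines x y s" "x * y' - x' * y \<noteq> 0" "\<bar>x * y' - x' * y\<bar> \<le> 1" for x y x' y'
  proof -
    obtain s' where s': "s' \<in> {1,-1}" "intertwines x' y' s'" using intertwines_exists by blast
    have "s * s' * e = 1" using intertwines_sign[OF that(1) s'(2) s(1) s'(1) that(2,3)] .
    then have "s' = s" using s(1) s'(1) by (auto simp: e_eq_1)
    then show ?thesis using s' by simp
  qed
  have X: "intertwines x 0 s" for x
  proof (cases "x = 0")
    case False
    \<comment> \<open>This height keeps the symplectic forms with (1,0) and with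
      \<open>(x, 0)\<close> within the bound 1.\<close>
    have "intertwines 0 (1 / (1 + \<bar>x\<bar>)) s"
      by (rule same[OF s(2)]) (auto simp: field_simps)
    then show ?thesis
      by (rule same) (use False in \<open>auto simp: abs_mult field_simps\<close>)
  qed (simp add: zero)
  have "intertwines 0 y s" for y
  proof (cases "y = 0")
    case False
    show ?thesis
      by (rule same[OF X[of "1 / (1 + \<bar>y\<bar>)"]]) (use False in \<open>auto simp: abs_mult field_simps\<close>)
  qed (simp add: zero)
  with X s(1) show ?thesis by blast
qed

end

section \<open>Isometries commuting with translations and modulations up to phase\<close>

text \<open>The condition \<open>p * q = 0\<close> selects pure translations or pure modulations,
  which compose without a phase; passing \<open>S\<close> in one step or in two then compares the
  factors.\<close>

lemma intertwining_character:
  assumes S: "\<And>u. u \<in> L2 \<Longrightarrow> S u \<in> L2"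
    and iso: "\<And>u v. u \<in> L2 \<Longrightarrow> v \<in> L2 \<Longrightarrow> ip (S u) (S v) = ip u v"
    and c: "\<And>r u. u \<in> L2 \<Longrightarrow>
      L2_eq (weyl (p * r) (q * r) (S u)) (\<lambda>t. c r * S (weyl (p * r) (q * r) u) t)"
    and pq: "p * q = 0"
  shows "c (r + r') = c r * c r'"
proof -
  have add: "weyl (p * r) (q * r) (weyl (p * r') (q * r') u) = weyl (p * (r + r')) (q * (r + r')) u" for u
    using pq by (auto simp: weyl_weyl distrib_left)
  obtain u where u: "u \<in> L2" "ip u u \<noteq> 0" using L2_nontrivial by blast
  define v where "v = weyl (p * (r + r')) (q * (r + r')) u"
  have v: "v \<in> L2" "ip v v \<noteq> 0" using u by (auto simp: v_def weyl_L2 ip_weyl_weyl)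
  have "L2_eq (\<lambda>t. c (r + r') * S v t) (weyl (p * (r + r')) (q * (r + r')) (S u))"
    unfolding v_def by (intro L2_eq_sym[OF c] u)
  also have "weyl (p * (r + r')) (q * (r + r')) (S u) =
      weyl (p * r) (q * r) (weyl (p * r') (q * r') (S u))"
    by (rule add[symmetric])
  also have "L2_eq \<dots> (\<lambda>t. c r' * c r * S v t)"
    unfolding v_def add[symmetric] by (intro weyl_weyl_intertwine[of S] S c u)
  finally have "ip (\<lambda>t. c (r + r') * S v t) (S v) = ip (\<lambda>t. c r' * c r * S v t) (S v)"
    using v by (intro ip_cong L2_eq_refl L2_scale S)
  then show ?thesis using v by (simp add: ip_scale_left iso)
qed

section \<open>Modulations and the Fourier transform\<close>

lemma ip_modulate: "ip (weyl 0 y u) v = (LINT t|lborel. iexp (- y * t) * (u t * cnj (v t)))"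
  by (simp add: ip_def weyl_def mult.assoc)

lemma isCont_ip_modulate:
  assumes "u \<in> L2" "v \<in> L2"
  shows "isCont (\<lambda>y. ip (weyl 0 y u) v) y"
proof -
  have "isCont (\<lambda>y. LINT t|lborel. iexp (y * t) * (u t * cnj (v t))) (- y)"
    by (intro isCont_fourier ip_integrable assms)
  then show ?thesis
    unfolding ip_modulate by (rule isCont_o2[rotated]) simp
qed

text \<open>The phases \<open>d\<close> form a continuous character with some frequency
  \<open>b\<close>, and translation by \<open>-b\<close> has the same phases. Hence the two products
  have equal Fourier transforms, and \<open>\<alpha> = -b\<close>.\<close>

lemma modulation_intertwiner:
  assumes S: "\<And>u. u \<in> L2 \<Longrightarrow> S u \<in> L2"
    and iso: "\<And>u v. u \<in> L2 \<Longrightarrow> v \<in> L2 \<Longrightarrow> ip (S u) (S v) = ip u v"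
    and d1: "\<And>y. cmod (d y) = 1"
    and d: "\<And>y u. u \<in> L2 \<Longrightarrow> L2_eq (weyl 0 y (S u)) (\<lambda>t. d y * S (weyl 0 y u) t)"
  shows "\<exists>\<alpha>. \<forall>u\<in>L2. \<forall>v\<in>L2. AE t in lborel. S u t * cnj (S v t) = u (t - \<alpha>) * cnj (v (t - \<alpha>))"
proof -
  have ipd: "ip (weyl 0 y (S u)) (S v) = d y * ip (weyl 0 y u) v" if "u \<in> L2" "v \<in> L2" for u v y
  proof -
    have "ip (weyl 0 y (S u)) (S v) = ip (\<lambda>t. d y * S (weyl 0 y u) t) (S v)"
      using that by (intro ip_cong d L2_eq_refl weyl_L2 L2_scale S)
    then show ?thesis using that by (simp add: ip_scale_left iso weyl_L2)
  qed
  have add: "d (y + y') = d y * d y'" for y y'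
    by (rule intertwining_character[of S 0 1]) (use S iso d in auto)
  obtain w where w: "w \<in> L2" "ip w w \<noteq> 0" using L2_nontrivial by blast
  have "isCont d 0"
  proof -
    have c: "isCont (\<lambda>y. ip (weyl 0 y w) w) 0" using w by (intro isCont_ip_modulate)
    have "\<forall>\<^sub>F y in nhds 0. ip (weyl 0 y w) w \<noteq> 0"
    proof -
      have "((\<lambda>y. ip (weyl 0 y w) w) \<longlongrightarrow> ip (weyl 0 0 w) w) (nhds 0)"
        using c tendsto_at_iff_tendsto_nhds[of "\<lambda>y. ip (weyl 0 y w) w" 0] by (simp add: isCont_def)
      then show ?thesis by (rule tendsto_imp_eventually_ne) (simp add: weyl_zero w)
    qed
    \<comment> \<open>Near 0 the denominator is nonzero, so \<open>d\<close> is a quotient of two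
      continuous Fourier transforms.\<close>
    then have ev: "\<forall>\<^sub>F y in nhds 0. ip (weyl 0 y (S w)) (S w) / ip (weyl 0 y w) w = d y"
      by eventually_elim (simp add: ipd w)
    have "isCont (\<lambda>y. ip (weyl 0 y (S w)) (S w) / ip (weyl 0 y w) w) 0"
      using w by (intro continuous_intros isCont_ip_modulate S) (auto simp: weyl_zero)
    then show ?thesis using ev by (simp add: isCont_cong)
  qed
  then obtain b where b: "\<And>y. d y = exp (\<i> * of_real b * of_real y)"
    using continuous_character[OF add d1] by blast
  have "AE t in lborel. S u t * cnj (S v t) = u (t - -b) * cnj (v (t - -b))"
    if uv: "u \<in> L2" "v \<in> L2" for u v
  proof -
    define f where "f t = S u t * cnj (S v t) - weyl (-b) 0 u t * cnj (weyl (-b) 0 v t)" for t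
    have i: "integrable lborel (\<lambda>t. S u t * cnj (S v t))"
      "integrable lborel (\<lambda>t. weyl (-b) 0 u t * cnj (weyl (-b) 0 v t))"
      by (intro ip_integrable S weyl_L2 uv)+
    have "AE t in lborel. f t = 0"
    proof (rule fourier_uniqueness)
      show "integrable lborel f"
        unfolding f_def[abs_def] by (intro Bochner_Integration.integrable_diff i)
      fix y
      have comm: "weyl 0 (-y) (weyl (-b) 0 u) = (\<lambda>t. d (-y) * weyl (-b) 0 (weyl 0 (-y) u) t)"
        by (subst weyl_commute) (simp add: b algebra_simps)
      have "(LINT t|lborel. iexp (y * t) * f t) =
          ip (weyl 0 (-y) (S u)) (S v) - ip (weyl 0 (-y) (weyl (-b) 0 u)) (weyl (-b) 0 v)"
        unfolding ip_modulate minus_minus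
          Bochner_Integration.integral_diff[OF integrable_iexp_mult[OF i(1)] integrable_iexp_mult[OF i(2)], symmetric] f_def right_diff_distrib ..
      also have "\<dots> = 0"
        unfolding comm ip_scale_left ip_weyl_weyl ipd[OF uv] by simp
      finally show "(LINT t|lborel. iexp (y * t) * f t) = 0" .
    qed
    then show ?thesis by eventually_elim (simp add: f_def weyl_def)
  qed
  then show ?thesis by blast
qed

lemma isCont_translate_gaussian:
  fixes m :: "real \<Rightarrow> complex"
  assumes [measurable]: "m \<in> borel_measurable borel" and m: "AE t in lborel. cmod (m t) = 1"
  shows "isCont (\<lambda>x. LINT t|lborel. complex_of_real (exp (- (t + x)\<^sup>2)) * iexp (y * (t + x)) * m t) 0"
  unfolding continuous_at_sequentially
proof safe
  fix X :: "nat \<Rightarrow> real" assume X: "X \<longlonglongrightarrow> 0"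
  then have "Bseq X" by (intro convergent_imp_Bseq convergentI)
  then obtain B where B: "\<And>n. \<bar>X n\<bar> \<le> B" by (auto simp: Bseq_def)
  \<comment> \<open>A single wider Gaussian dominates all translates by at most \<open>B\<close>;
    the pointwise bound follows by completing a square.\<close>
  have gauss: "integrable lborel (\<lambda>t. exp (B\<^sup>2) * exp (- t\<^sup>2 / 2))"
  proof -
    have "integrable lborel (\<lambda>t. exp (B\<^sup>2) * (sqrt (2 * pi) * normal_density 0 1 t))"
      by (intro integrable_mult_right integrable_normal_density) auto
    then show ?thesis by (simp add: normal_density_def)
  qed
  have bound: "exp (- (t + X n)\<^sup>2) \<le> exp (B\<^sup>2) * exp (- t\<^sup>2 / 2)" for n t
  proof -
    have "(X n)\<^sup>2 \<le> B\<^sup>2" using B[of n] by (metis abs_ge_zero power2_abs power_mono)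
    moreover have "(t + X n)\<^sup>2 - t\<^sup>2 / 2 + (X n)\<^sup>2 = (t + 2 * X n)\<^sup>2 / 2"
      by (simp add: power2_eq_square field_simps)
    ultimately have "- (t + X n)\<^sup>2 \<le> B\<^sup>2 + - t\<^sup>2 / 2"
      using zero_le_power2[of "t + 2 * X n"] by linarith
    then show ?thesis by (simp only: exp_add[symmetric] exp_le_cancel_iff)
  qed
  show "((\<lambda>x. LINT t|lborel. complex_of_real (exp (- (t + x)\<^sup>2)) * iexp (y * (t + x)) * m t) \<circ> X)
      \<longlonglongrightarrow> (LINT t|lborel. complex_of_real (exp (- (t + 0)\<^sup>2)) * iexp (y * (t + 0)) * m t)"
    unfolding comp_def
  proof (rule integral_dominated_convergence[OF _ _ gauss])
    show "AE t in lborel. norm (complex_of_real (exp (- (t + X n)\<^sup>2)) * iexp (y * (t + X n)) * m t)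
        \<le> exp (B\<^sup>2) * exp (- t\<^sup>2 / 2)" for n
      using m by eventually_elim (use bound[of _ n] in \<open>simp add: norm_mult del: of_real_add\<close>)
    show "AE t in lborel. (\<lambda>n. complex_of_real (exp (- (t + X n)\<^sup>2)) * iexp (y * (t + X n)) * m t)
        \<longlonglongrightarrow> complex_of_real (exp (- (t + 0)\<^sup>2)) * iexp (y * (t + 0)) * m t"
      by (intro AE_I2 tendsto_intros X)
  qed simp_all
qed

text \<open>Integration against a translated, modulated Gaussian transfers continuity to
  \<open>c\<close>, so \<open>c\<close> is an exponential. Fubini's theorem then yields one base
  point \<open>s\<close> from which \<open>m\<close> is known almost everywhere.\<close>

lemma quasi_periodic_all_shifts:
  fixes m c :: "real \<Rightarrow> complex"
  assumes [measurable]: "m \<in> borel_measurable borel" and m: "AE t in lborel. cmod (m t) = 1"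
    and mc: "\<And>x. AE t in lborel. m (t - x) = c x * m t"
    and add: "\<And>x y. c (x + y) = c x * c y" and c1: "\<And>x. cmod (c x) = 1"
  shows "\<exists>k \<beta>. cmod k = 1 \<and> (AE t in lborel. m t = k * exp (\<i> * of_real \<beta> * of_real t))"
proof -
  have i: "integrable lborel (\<lambda>t. complex_of_real (exp (- t\<^sup>2)) * m t)"
  proof (rule Bochner_Integration.integrable_bound)
    have "integrable lborel (\<lambda>t. sqrt pi * normal_density 0 (1 / sqrt 2) t)"
      by (intro integrable_mult_right integrable_normal_density) auto
    then show "integrable lborel (\<lambda>t::real. exp (- t\<^sup>2))"
      by (simp add: normal_density_def power_divide)
    show "AE t in lborel. norm (complex_of_real (exp (- t\<^sup>2)) * m t) \<le> norm (exp (- t\<^sup>2))"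
      using m by eventually_elim (simp add: norm_mult)
  qed simp
  have "\<not> (AE t in lborel. complex_of_real (exp (- t\<^sup>2)) * m t = 0)"
  proof
    assume "AE t in lborel. complex_of_real (exp (- t\<^sup>2)) * m t = 0"
    with m have "AE t in (lborel :: real measure). False" by eventually_elim auto
    then show False by (simp add: eventually_False ae_filter_eq_bot_iff)
  qed
  \<comment> \<open>Some Fourier coefficient of the nonzero function is nonzero; this frequency
    ensures \<open>H 0 \<noteq> 0\<close>.\<close>
  then obtain y where y: "(LINT t|lborel. iexp (y * t) * (complex_of_real (exp (- t\<^sup>2)) * m t)) \<noteq> 0"
    using fourier_uniqueness[OF i] by blast
  define H where "H x = (LINT t|lborel. complex_of_real (exp (- (t + x)\<^sup>2)) * iexp (y * (t + x)) * m t)" for x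
  have H0: "H 0 \<noteq> 0" using y by (simp add: H_def mult_ac)
  have H: "H x = c x * H 0" for x
  proof -
    have "H x = (LINT t|lborel. complex_of_real (exp (- t\<^sup>2)) * iexp (y * t) * m (t - x))"
      unfolding H_def
      using lborel_integral_real_affine[of 1 "\<lambda>t. complex_of_real (exp (- t\<^sup>2)) * iexp (y * t) * m (t - x)" x]
      by (simp add: add.commute)
    also have "\<dots> = (LINT t|lborel. c x * (complex_of_real (exp (- t\<^sup>2)) * iexp (y * t) * m t))"
      by (rule integral_cong_AE) (use mc[of x] in \<open>auto elim: eventually_mono\<close>)
    also have "\<dots> = c x * H 0" by (simp add: H_def)
    finally show ?thesis .
  qed
  have "isCont (\<lambda>x. H x / H 0) 0"
    using isCont_translate_gaussian[OF assms(1) m, of y] H0 unfolding H_def[symmetric, abs_def]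
    by (intro continuous_intros) auto
  moreover have "(\<lambda>x. H x / H 0) = c"
    by (rule ext) (subst H, simp add: H0)
  ultimately have "isCont c 0" by simp
  then obtain b where b: "\<And>x. c x = exp (\<i> * of_real b * of_real x)"
    using continuous_character[OF add c1] by blast
  have meas: "{p \<in> space (lborel \<Otimes>\<^sub>M lborel).
      m (fst p - snd p) = exp (\<i> * of_real b * of_real (snd p)) * m (fst p)} \<in> sets (lborel \<Otimes>\<^sub>M lborel)"
    by measurable
  have "AE x in lborel. AE t in lborel. m (t - x) = exp (\<i> * of_real b * of_real x) * m t"
    using mc b by simp
  then have "AE t in lborel. AE x in lborel. m (t - x) = exp (\<i> * of_real b * of_real x) * m t"
    by (subst lborel_pair.AE_commute) (use meas in simp_all)
  with m have "AE t in lborel. cmod (m t) = 1 \<and>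
      (AE x in lborel. m (t - x) = exp (\<i> * of_real b * of_real x) * m t)"
    by eventually_elim simp
  then have "\<exists>t. cmod (m t) = 1 \<and>
      (AE x in lborel. m (t - x) = exp (\<i> * of_real b * of_real x) * m t)"
    by (rule eventually_happens'[rotated]) (simp add: ae_filter_eq_bot_iff)
  then obtain s where s: "cmod (m s) = 1"
    "AE x in lborel. m (s - x) = exp (\<i> * of_real b * of_real x) * m s" by blast
  \<comment> \<open>The substitution \<open>x = s - t\<close> turns the relation at \<open>s\<close>
    into a formula for \<open>m t\<close>.\<close>
  have "AE t in lborel. m (s - (s + -1 * t)) = exp (\<i> * of_real b * of_real (s + -1 * t)) * m s"
    by (rule AE_borel_affine[OF _ _ s(2)]) auto
  then have "AE t in lborel. m t = (m s * exp (\<i> * of_real (b * s))) * exp (\<i> * of_real (-b) * of_real t)"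
    by eventually_elim (simp add: exp_add[symmetric] algebra_simps exp_diff exp_minus divide_inverse)
  moreover have "cmod (m s * exp (\<i> * of_real (b * s))) = 1"
    using s(1) by (simp only: norm_mult cmod_exp_i mult_1)
  ultimately show ?thesis by blast
qed

lemma weyl_intertwiner:
  assumes S: "\<And>u. u \<in> L2 \<Longrightarrow> S u \<in> L2"
    and iso: "\<And>u v. u \<in> L2 \<Longrightarrow> v \<in> L2 \<Longrightarrow> ip (S u) (S v) = ip u v"
    and tr: "\<And>x. \<exists>c. cmod c = 1 \<and> (\<forall>u\<in>L2. L2_eq (weyl x 0 (S u)) (\<lambda>t. c * S (weyl x 0 u) t))"
    and mo: "\<And>y. \<exists>c. cmod c = 1 \<and> (\<forall>u\<in>L2. L2_eq (weyl 0 y (S u)) (\<lambda>t. c * S (weyl 0 y u) t))"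
  shows "\<exists>c \<alpha> \<beta>. cmod c = 1 \<and>
    (\<forall>u\<in>L2. L2_eq (S u) (\<lambda>t. c * exp (\<i> * of_real \<beta> * of_real t) * u (t - \<alpha>)))"
proof -
  obtain d where d: "\<And>y. cmod (d y) = 1"
    "\<And>y u. u \<in> L2 \<Longrightarrow> L2_eq (weyl 0 y (S u)) (\<lambda>t. d y * S (weyl 0 y u) t)"
    using mo by metis
  obtain c where c: "\<And>x. cmod (c x) = 1"
    "\<And>x u. u \<in> L2 \<Longrightarrow> L2_eq (weyl x 0 (S u)) (\<lambda>t. c x * S (weyl x 0 u) t)"
    using tr by metis
  obtain \<alpha> where \<alpha>: "\<And>u v. u \<in> L2 \<Longrightarrow> v \<in> L2 \<Longrightarrow>
      AE t in lborel. S u t * cnj (S v t) = u (t - \<alpha>) * cnj (v (t - \<alpha>))"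
    using modulation_intertwiner[OF S iso d] by blast
  define g where "g t = complex_of_real (exp (- t\<^sup>2))" for t :: real
  have g: "g \<in> L2" "\<And>t. g t \<noteq> 0" using L2_nonvanishing by (auto simp: g_def[abs_def])
  have [measurable]: "g \<in> borel_measurable borel" "S g \<in> borel_measurable borel"
    using g S by (auto intro: L2_measurable)
  \<comment> \<open>Dividing the product identity for the pair \<open>u\<close>, \<open>g\<close> by
    \<open>cnj (S g t)\<close> gives \<open>S u t = m t * u (t - \<alpha>)\<close>.\<close>
  define m where "m t = cnj (g (t - \<alpha>)) / cnj (S g t)" for t
  have [measurable]: "m \<in> borel_measurable borel" unfolding m_def[abs_def] by measurable
  have nz: "AE t in lborel. S g t \<noteq> 0 \<and> cmod (m t) = 1"
    using \<alpha>[OF g(1) g(1)]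
  proof eventually_elim
    case (elim t)
    have "(cmod (S g t))\<^sup>2 = (cmod (g (t - \<alpha>)))\<^sup>2"
      using elim by (metis complex_norm_square of_real_eq_iff)
    then have "cmod (S g t) = cmod (g (t - \<alpha>))" by simp
    then show ?case using g(2)[of "t - \<alpha>"] by (auto simp: m_def norm_divide)
  qed
  have m1: "AE t in lborel. cmod (m t) = 1" using nz by (auto elim: eventually_mono)
  have Sm: "AE t in lborel. S u t = m t * u (t - \<alpha>)" if "u \<in> L2" for u
    using nz \<alpha>[OF that g(1)]
    by eventually_elim (auto simp: m_def field_simps)
  \<comment> \<open>The multiplier formula is applied to \<open>g\<close> and to its translate by
    \<open>x\<close>; the intertwining relation compares the two, and the nonvanishing
    \<open>g\<close> cancels.\<close>
  have mc: "AE t in lborel. m (t - x) = c x * m t" for x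
  proof -
    have "AE t in lborel. S g (- x + 1 * t) = m (- x + 1 * t) * g ((- x + 1 * t) - \<alpha>)"
      by (rule AE_borel_affine[OF _ _ Sm[OF g(1)]]) auto
    then show ?thesis
      using Sm[OF weyl_L2[OF g(1), of x 0]] c(2)[OF g(1), of x, unfolded L2_eq_def]
    proof eventually_elim
      case (elim t)
      have "m (t - x) * g (t - x - \<alpha>) = c x * m t * g (t - x - \<alpha>)"
        using elim by (simp add: weyl_def algebra_simps)
      then show ?case using g(2) by simp
    qed
  qed
  have add: "c (x + x') = c x * c x'" for x x'
    by (rule intertwining_character[of S 1 0]) (use S iso c in auto)
  obtain k \<beta> where k: "cmod k = 1" "AE t in lborel. m t = k * exp (\<i> * of_real \<beta> * of_real t)"
    using quasi_periodic_all_shifts[OF _ m1 mc add c(1)] by auto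
  have "L2_eq (S u) (\<lambda>t. k * exp (\<i> * of_real \<beta> * of_real t) * u (t - \<alpha>))" if "u \<in> L2" for u
    unfolding L2_eq_def using k(2) Sm[OF that] by eventually_elim simp
  with k(1) show ?thesis by blast
qed

section \<open>Ambiguity-preserving operators\<close>

context ambiguity_preserver
begin

lemma preserver_form:
  "\<exists>c \<alpha> \<beta>. cmod c = 1 \<and>
    ((\<forall>u\<in>L2. L2_eq (T u) (\<lambda>t. c * exp (\<i> * of_real \<beta> * of_real t) * u (t - \<alpha>))) \<or>
     (\<forall>u\<in>L2. L2_eq (T u) (\<lambda>t. c * exp (- \<i> * of_real \<beta> * of_real t) * u (- t - \<alpha>))))"
proof -
  obtain s where s: "s \<in> {1,-1}" "\<And>x. intertwines x 0 s" "\<And>y. intertwines 0 y s"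
    using intertwines_uniform by blast
  \<comment> \<open>For \<open>s = -1\<close> the reflection reverses every shift, so
    \<open>T\<close> composed with \<open>R\<close> intertwines with sign 1.\<close>
  define R where "R = (if s = 1 then id else reflect)"
  have R_L2: "R u \<in> L2" if "u \<in> L2" for u using that by (simp add: R_def reflect_L2)
  have R_ip: "ip (R u) (R v) = ip u v" for u v by (simp add: R_def ip_reflect)
  have R_R: "R (R u) = u" for u by (simp add: R_def reflect_reflect)
  have R_weyl: "weyl (s * x) (s * y) (R u) = R (weyl x y u)" for x y u
    using s(1) by (auto simp: R_def reflect_weyl)
  have "\<exists>c \<alpha> \<beta>. cmod c = 1 \<and>
    (\<forall>u\<in>L2. L2_eq ((T \<circ> R) u) (\<lambda>t. c * exp (\<i> * of_real \<beta> * of_real t) * u (t - \<alpha>)))"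
  proof (rule weyl_intertwiner)
    have *: "\<exists>c. cmod c = 1 \<and> (\<forall>u\<in>L2. L2_eq (weyl x y ((T \<circ> R) u)) (\<lambda>t. c * (T \<circ> R) (weyl x y u) t))"
      if i: "intertwines x y s" for x y
    proof -
      obtain c where c: "cmod c = 1"
        "\<And>u. u \<in> L2 \<Longrightarrow> L2_eq (weyl x y (T u)) (\<lambda>t. c * T (weyl (s * x) (s * y) u) t)"
        using i[unfolded intertwines_def] e_eq_1 by auto
      show ?thesis using c(1) c(2)[OF R_L2] by (auto simp: R_weyl)
    qed
    show "\<exists>c. cmod c = 1 \<and> (\<forall>u\<in>L2. L2_eq (weyl x 0 ((T \<circ> R) u)) (\<lambda>t. c * (T \<circ> R) (weyl x 0 u) t))" for x
      by (intro * s)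
    show "\<exists>c. cmod c = 1 \<and> (\<forall>u\<in>L2. L2_eq (weyl 0 y ((T \<circ> R) u)) (\<lambda>t. c * (T \<circ> R) (weyl 0 y u) t))" for y
      by (intro * s)
  qed (simp_all add: T_L2 R_L2 T_isometry R_ip)
  then obtain c \<alpha> \<beta> where c: "cmod c = 1"
    "\<And>u. u \<in> L2 \<Longrightarrow> L2_eq (T (R u)) (\<lambda>t. c * exp (\<i> * of_real \<beta> * of_real t) * u (t - \<alpha>))"
    by auto
  have T: "L2_eq (T u) (\<lambda>t. c * exp (\<i> * of_real \<beta> * of_real t) * R u (t - \<alpha>))" if "u \<in> L2" for u
    using c(2)[OF R_L2[OF that]] by (simp add: R_R)
  show ?thesis
  proof (cases "s = 1")
    case True
    then have "\<forall>u\<in>L2. L2_eq (T u) (\<lambda>t. c * exp (\<i> * of_real \<beta> * of_real t) * u (t - \<alpha>))"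
      using T by (simp add: R_def)
    then show ?thesis using c(1) by blast
  next
    case False
    then have "\<forall>u\<in>L2. L2_eq (T u) (\<lambda>t. c * exp (- \<i> * of_real (-\<beta>) * of_real t) * u (- t - (-\<alpha>)))"
      using T by (simp add: R_def reflect_def add.commute)
    then show ?thesis using c(1) by blast
  qed
qed

end

section \<open>Both directions of the characterization\<close>

lemma cmod_ambiguity_scale: "cmod c = 1 \<Longrightarrow> cmod (ambiguity (\<lambda>t. c * u t) x y) = cmod (ambiguity u x y)"
  by (simp add: ambiguity_scale norm_mult)

lemma cmod_ambiguity_weyl: "cmod (ambiguity (weyl a b u) x y) = cmod (ambiguity u x y)"
  by (simp only: ambiguity_weyl norm_mult cmod_exp_i mult_1)

theorem theoremC:
  fixes T :: "(real \<Rightarrow> complex) \<Rightarrow> real \<Rightarrow> complex"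
  assumes "L2_map T"
  shows
    "(L2_bounded T \<and> (L2_linear T \<or> L2_antilinear T) \<and>
       (\<forall>u\<in>L2. \<forall>x y. cmod (ambiguity (T u) x y) = cmod (ambiguity u x y)) \<longrightarrow>
      (\<exists>(c::complex) (\<alpha>::real) (\<beta>::real). cmod c = 1 \<and>
         ((\<forall>u\<in>L2. L2_eq (T u)
              (\<lambda>t. c * exp (\<i> * complex_of_real \<beta> * complex_of_real t) * u (t - \<alpha>))) \<or>
          (\<forall>u\<in>L2. L2_eq (T u)
              (\<lambda>t. c * exp (- \<i> * complex_of_real \<beta> * complex_of_real t) * u (- t - \<alpha>))))))
     \<and>
     (\<forall>(c::complex) (\<alpha>::real) (\<beta>::real). cmod c = 1 \<and>
         ((\<forall>u\<in>L2. L2_eq (T u)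
              (\<lambda>t. c * exp (\<i> * complex_of_real \<beta> * complex_of_real t) * u (t - \<alpha>))) \<or>
          (\<forall>u\<in>L2. L2_eq (T u)
              (\<lambda>t. c * exp (- \<i> * complex_of_real \<beta> * complex_of_real t) * u (- t - \<alpha>)))) \<longrightarrow>
       (\<forall>u\<in>L2. \<forall>x y. cmod (ambiguity (T u) x y) = cmod (ambiguity u x y)))"
proof (intro conjI impI allI ballI)
  assume *: "L2_bounded T \<and> (L2_linear T \<or> L2_antilinear T) \<and>
    (\<forall>u\<in>L2. \<forall>x y. cmod (ambiguity (T u) x y) = cmod (ambiguity u x y))"
  then have amb: "\<And>u x y. u \<in> L2 \<Longrightarrow> cmod (ambiguity (T u) x y) = cmod (ambiguity u x y)"
    by blast
  have "L2_linear T"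
  proof (rule ccontr)
    \<comment> \<open>Precomposing with conjugation makes the operator linear and reverses
      \<open>y\<close> in the ambiguity function, which is the excluded case
      \<open>e = -1\<close>.\<close>
    assume "\<not> L2_linear T"
    then have anti: "L2_antilinear T" using * by blast
    have "L2_map (\<lambda>u. T (\<lambda>t. cnj (u t)))"
      using assms L2_cnj unfolding L2_map_def L2_eq_def by simp
    moreover have "L2_linear (\<lambda>u. T (\<lambda>t. cnj (u t)))"
      unfolding L2_linear_def L2_additive_def
    proof (intro conjI allI ballI)
      fix u v assume "u \<in> L2" "v \<in> L2"
      then show "L2_eq (T (\<lambda>t. cnj (u t + v t))) (\<lambda>t. T (\<lambda>t. cnj (u t)) t + T (\<lambda>t. cnj (v t)) t)"
        using anti by (simp add: L2_antilinear_def L2_additive_def L2_cnj)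
    next
      fix a u assume "u \<in> L2"
      then have "L2_eq (T (\<lambda>t. cnj a * cnj (u t))) (\<lambda>t. cnj (cnj a) * T (\<lambda>t. cnj (u t)) t)"
        using anti L2_cnj[of u] by (simp only: L2_antilinear_def)
      then show "L2_eq (T (\<lambda>t. cnj (a * u t))) (\<lambda>t. a * T (\<lambda>t. cnj (u t)) t)" by simp
    qed
    ultimately interpret ambiguity_preserver "\<lambda>u. T (\<lambda>t. cnj (u t))" "-1"
      by unfold_locales (auto simp: amb L2_cnj ambiguity_cnj)
    show False using e_eq_1 by simp
  qed
  then interpret ambiguity_preserver T 1
    by unfold_locales (auto simp: assms amb)
  show "\<exists>(c::complex) (\<alpha>::real) (\<beta>::real). cmod c = 1 \<and>
         ((\<forall>u\<in>L2. L2_eq (T u)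
              (\<lambda>t. c * exp (\<i> * complex_of_real \<beta> * complex_of_real t) * u (t - \<alpha>))) \<or>
          (\<forall>u\<in>L2. L2_eq (T u)
              (\<lambda>t. c * exp (- \<i> * complex_of_real \<beta> * complex_of_real t) * u (- t - \<alpha>))))"
    by (rule preserver_form)
next
  fix c \<alpha> \<beta> u x y
  assume *: "cmod c = 1 \<and>
         ((\<forall>u\<in>L2. L2_eq (T u)
              (\<lambda>t. c * exp (\<i> * complex_of_real \<beta> * complex_of_real t) * u (t - \<alpha>))) \<or>
          (\<forall>u\<in>L2. L2_eq (T u)
              (\<lambda>t. c * exp (- \<i> * complex_of_real \<beta> * complex_of_real t) * u (- t - \<alpha>))))"
    and u: "u \<in> L2"
  have T: "T u \<in> L2" using assms u by (simp add: L2_map_def)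
  \<comment> \<open>Both forms are unimodular multiples of a phase space shift, the second one
    reflected; \<open>-\<beta>\<close> compensates the minus sign in \<open>weyl\<close>.\<close>
  have "L2_eq (T u) (\<lambda>t. c * weyl \<alpha> (-\<beta>) u t) \<or> L2_eq (T u) (\<lambda>t. c * reflect (weyl \<alpha> (-\<beta>) u) t)"
    using * u by (auto simp: weyl_def reflect_def mult.assoc)
  then show "cmod (ambiguity (T u) x y) = cmod (ambiguity u x y)"
  proof
    assume "L2_eq (T u) (\<lambda>t. c * weyl \<alpha> (-\<beta>) u t)"
    then have "ambiguity (T u) x y = ambiguity (\<lambda>t. c * weyl \<alpha> (-\<beta>) u t) x y"
      using T u by (intro ambiguity_cong L2_scale weyl_L2)
    then show ?thesis using * by (simp add: cmod_ambiguity_scale cmod_ambiguity_weyl)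
  next
    assume "L2_eq (T u) (\<lambda>t. c * reflect (weyl \<alpha> (-\<beta>) u) t)"
    then have "ambiguity (T u) x y = ambiguity (\<lambda>t. c * reflect (weyl \<alpha> (-\<beta>) u) t) x y"
      using T u by (intro ambiguity_cong L2_scale reflect_L2 weyl_L2)
    then show ?thesis
      using * by (simp add: cmod_ambiguity_scale ambiguity_reflect cmod_ambiguity_weyl ambiguity_uminus)
  qed
qed

end
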